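(* Let $RE$ be the sub-pca of Scott's graph model consisting of the recursively enumerable subsets of $\mathbb{N}$, let $Eq$ be the function on $RE$ deciding equality ($Eq([A,B])=\mathsf{T}$ if $A=B$ and $\mathsf{F}$ otherwise), and let $C$ be the partial function on $RE$ whose domain is the set $Rec\subset RE$ of recursive sets, given by $C(A)=\mathbb{N}-A$. Then $C$ is representable in $RE[Eq]$.
   Context: A partial combinatory algebra (pca) is a set $\mathcal{A}$ with a partial binary application $(a,b)\mapsto ab$ (associating to the left) such that there are $\mathsf{k},\mathsf{s}\in\mathcal{A}$ with, for all $a,b,c$: $\mathsf{k}ab=a$; $\mathsf{s}ab$ is defined; and whenever $(ac)(bc)$ is defined, $\mathsf{s}abc$ is defined and equals $(ac)(bc)$. A partial function $f:\mathcal{A}\to\mathcal{A}$ is representable in $\mathcal{A}$ if there is $a_f\in\mathcal{A}$ with $a_fa=f(a)$ for all $a$ in the domain of $f$ (no condition outside the domain). Every pca contains booleans $\mathsf{T},\mathsf{F}$ with a definition-by-cases element $D$ ($D\mathsf{T}ab=a$, $D\mathsf{F}ab=b$), and standard codings $[a,b]$ of pairs and $[a_0,\ldots,a_{n-1}]$ of finite sequences whose basic operations (length, projections, appending) are representable; fix such choices. For a pca $\mathcal{A}$ and a partial function $f:\mathcal{A}\to\mathcal{A}$, $\mathcal{A}[f]$ is the pca with underlying set $\mathcal{A}$ and application $\cdot_f$ defined by: $a\cdot_f b=c$ iff there is a finite sequence $e_0,\ldots,e_{n-1}$ in $\mathcal{A}$ (on each of which $f$ is defined) such that $a[b,f(e_0),\ldots,f(e_{i-1})]=[\mathsf{F},e_i]$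 for all $i<n$ and $a[b,f(e_0),\ldots,f(e_{n-1})]=[\mathsf{T},c]$. Scott's graph model is the set $\mathcal{P}(\mathbb{N})$ with application $A\circ B=\{n\mid \exists m\,([m,n]\in A,\ e_m\subseteq B)\}$, where $[\cdot,\cdot]$ is a standard (recursive, bijective) pairing on $\mathbb{N}$ and $e_k$ is the finite set $p$ with $k=\sum_{i\in p}2^i$. $RE$, with the same application, is a pca (a sub-pca of $\mathcal{P}(\mathbb{N})$, i.e. it contains elements $\mathsf{k},\mathsf{s}$ serving for both). *)

theory Defs
  imports Main "HOL-Library.Nat_Bijection"
begin

section \<open>Partial applicative structures and codings\<close>

record 'a applicative =
  carrier :: "'a set"
  app :: "'a \<Rightarrow> 'a \<Rightarrow> 'a option"

text \<open>Iterated application, associating to the left: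
  \<open>apps P a [b\<^sub>1, \<dots>, b\<^sub>n]\<close> is \<open>a b\<^sub>1 \<dots> b\<^sub>n\<close>.\<close>

primrec apps :: "('a, 'm) applicative_scheme \<Rightarrow> 'a \<Rightarrow> 'a list \<Rightarrow> 'a option" where
  "apps P a [] = Some a"
| "apps P a (b # bs) = Option.bind (app P a b) (\<lambda>c. apps P c bs)"

definition representable :: "('a, 'm) applicative_scheme \<Rightarrow> ('a \<Rightarrow> 'a option) \<Rightarrow> bool" where
  "representable P f \<longleftrightarrow> (\<exists>a\<in>carrier P. \<forall>x\<in>dom f. app P a x = f x)"

text \<open>A choice of booleans and of codings of pairs, natural numbers and finite sequences. The
  numerals serve as values of the length function and as indices of the projections.\<close>

record 'a codings =
  tru :: 'a
  fls :: 'a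
  pair :: "'a \<Rightarrow> 'a \<Rightarrow> 'a"
  nmrl :: "nat \<Rightarrow> 'a"
  tuple :: "'a list \<Rightarrow> 'a"

definition has_booleans :: "('a, 'm) applicative_scheme \<Rightarrow> ('a, 'n) codings_scheme \<Rightarrow> bool" where
  "has_booleans P K \<longleftrightarrow>
     tru K \<in> carrier P \<and> fls K \<in> carrier P \<and>
     (\<exists>d\<in>carrier P. \<forall>a\<in>carrier P. \<forall>b\<in>carrier P.
        apps P d [tru K, a, b] = Some a \<and> apps P d [fls K, a, b] = Some b)"

definition has_pairs :: "('a, 'm) applicative_scheme \<Rightarrow> ('a, 'n) codings_scheme \<Rightarrow> bool" where
  "has_pairs P K \<longleftrightarrow>
     (\<forall>a\<in>carrier P. \<forall>b\<in>carrier P. pair K a b \<in> carrier P) \<and>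
     (\<exists>p\<in>carrier P. \<forall>a\<in>carrier P. \<forall>b\<in>carrier P. apps P p [a, b] = Some (pair K a b)) \<and>
     (\<exists>p0\<in>carrier P. \<forall>a\<in>carrier P. \<forall>b\<in>carrier P. app P p0 (pair K a b) = Some a) \<and>
     (\<exists>p1\<in>carrier P. \<forall>a\<in>carrier P. \<forall>b\<in>carrier P. app P p1 (pair K a b) = Some b)"

definition has_numerals :: "('a, 'm) applicative_scheme \<Rightarrow> ('a, 'n) codings_scheme \<Rightarrow> bool" where
  "has_numerals P K \<longleftrightarrow>
     (\<forall>n. nmrl K n \<in> carrier P) \<and>
     (\<exists>s\<in>carrier P. \<forall>n. app P s (nmrl K n) = Some (nmrl K (Suc n))) \<and>
     (\<exists>p\<in>carrier P. \<forall>n. app P p (nmrl K (Suc n)) = Some (nmrl K n)) \<and>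
     (\<exists>z\<in>carrier P. app P z (nmrl K 0) = Some (tru K) \<and>
                      (\<forall>n. app P z (nmrl K (Suc n)) = Some (fls K)))"

definition has_sequences :: "('a, 'm) applicative_scheme \<Rightarrow> ('a, 'n) codings_scheme \<Rightarrow> bool" where
  "has_sequences P K \<longleftrightarrow>
     (\<forall>xs\<in>lists (carrier P). tuple K xs \<in> carrier P) \<and>
     (\<exists>l\<in>carrier P. \<forall>xs\<in>lists (carrier P). app P l (tuple K xs) = Some (nmrl K (length xs))) \<and>
     (\<exists>q\<in>carrier P. \<forall>xs\<in>lists (carrier P). \<forall>i<length xs.
        apps P q [nmrl K i, tuple K xs] = Some (xs ! i)) \<and>
     (\<exists>r\<in>carrier P. \<forall>xs\<in>lists (carrier P). \<forall>a\<in>carrier P.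
        apps P r [tuple K xs, a] = Some (tuple K (xs @ [a])))"

definition standard_codings :: "('a, 'm) applicative_scheme \<Rightarrow> ('a, 'n) codings_scheme \<Rightarrow> bool" where
  "standard_codings P K \<longleftrightarrow>
     has_booleans P K \<and> has_pairs P K \<and> has_numerals P K \<and> has_sequences P K"


section \<open>Adjoining a partial function\<close>

text \<open>\<open>dialogue P K f a b es c\<close>: from input \<open>b\<close>, the element \<open>a\<close> asks the queries \<open>es\<close> of the
  oracle \<open>f\<close> and then returns \<open>c\<close>.\<close>

definition dialogue ::
  "('a, 'm) applicative_scheme \<Rightarrow> ('a, 'n) codings_scheme \<Rightarrow> ('a \<Rightarrow> 'a option) \<Rightarrow>
   'a \<Rightarrow> 'a \<Rightarrow> 'a list \<Rightarrow> 'a \<Rightarrow> bool" where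
  "dialogue P K f a b es c \<longleftrightarrow>
     set es \<subseteq> carrier P \<inter> dom f \<and> c \<in> carrier P \<and>
     (\<forall>i<length es.
        app P a (tuple K (b # map (the \<circ> f) (take i es))) = Some (pair K (fls K) (es ! i))) \<and>
     app P a (tuple K (b # map (the \<circ> f) es)) = Some (pair K (tru K) c)"

definition adjoin ::
  "('a, 'm) applicative_scheme \<Rightarrow> ('a, 'n) codings_scheme \<Rightarrow> ('a \<Rightarrow> 'a option) \<Rightarrow> 'a applicative" where
  "adjoin P K f =
     \<lparr>carrier = carrier P,
      app = (\<lambda>a b. if \<exists>c es. dialogue P K f a b es c
                   then Some (THE c. \<exists>es. dialogue P K f a b es c) else None)\<rparr>"

lemma pair_inject:
  assumes "has_pairs P K" "pair K a b = pair K a' b'"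
    and "a \<in> carrier P" "b \<in> carrier P" "a' \<in> carrier P" "b' \<in> carrier P"
  shows "a = a' \<and> b = b'"
  using assms unfolding has_pairs_def by (metis option.inject)

lemma booleans_trivial:
  assumes "has_booleans P K" "tru K = fls K" "a \<in> carrier P" "b \<in> carrier P"
  shows "a = b"
  using assms unfolding has_booleans_def by (metis option.inject)

lemma dialogue_unique:
  assumes codings: "has_booleans P K" "has_pairs P K"
    and d: "dialogue P K f a b es c" and d': "dialogue P K f a b es' c'"
  shows "c = c'"
proof (cases "tru K = fls K")
  case True
  then show ?thesis using booleans_trivial codings d d' unfolding dialogue_def by metis
next
  case False
  have bools: "tru K \<in> carrier P" "fls K \<in> carrier P"
    using codings(1) unfolding has_booleans_def by auto
  have agree: "take i es = take i es'" if "i \<le> length es" "i \<le> length es'" for i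
    using that
  proof (induction i)
    case (Suc i)
    then have IH: "take i es = take i es'" by simp
    have "app P a (tuple K (b # map (the \<circ> f) (take i es))) = Some (pair K (fls K) (es ! i))"
      using d Suc.prems unfolding dialogue_def by auto
    moreover have "app P a (tuple K (b # map (the \<circ> f) (take i es'))) = Some (pair K (fls K) (es' ! i))"
      using d' Suc.prems unfolding dialogue_def by auto
    moreover have "es ! i \<in> carrier P" "es' ! i \<in> carrier P"
      using d d' Suc.prems unfolding dialogue_def by (auto simp: subset_iff)
    ultimately have "es ! i = es' ! i"
      using pair_inject[OF codings(2)] bools IH by (metis option.inject)
    then show ?case using IH Suc.prems by (simp add: take_Suc_conv_app_nth)
  qed simp
  have no_less: False
    if e: "dialogue P K f a b xs x" "dialogue P K f a b ys y"
      and "length xs < length ys" "xs = take (length xs) ys" for xs ys x y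
  proof -
    have "app P a (tuple K (b # map (the \<circ> f) xs)) = Some (pair K (fls K) (ys ! length xs))"
      using e(2) that(3,4) unfolding dialogue_def by metis
    moreover have "app P a (tuple K (b # map (the \<circ> f) xs)) = Some (pair K (tru K) x)"
      using e(1) unfolding dialogue_def by auto
    moreover have "ys ! length xs \<in> carrier P" "x \<in> carrier P"
      using e that(3) unfolding dialogue_def by (auto simp: subset_iff)
    ultimately show False
      using pair_inject[OF codings(2)] bools False by (metis option.inject)
  qed
  have "length es = length es'"
    using no_less[OF d d'] no_less[OF d' d] agree[of "length es"] agree[of "length es'"]
    by (cases "length es" "length es'" rule: linorder_cases) auto
  then have "es = es'" using agree[of "length es"] by simp
  then have "pair K (tru K) c = pair K (tru K) c'" using d d' unfolding dialogue_def by simp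
  then show ?thesis
    using pair_inject[OF codings(2)] bools d d' unfolding dialogue_def by blast
qed

lemma app_adjoin_iff:
  assumes "standard_codings P K"
  shows "app (adjoin P K f) a b = Some c \<longleftrightarrow> (\<exists>es. dialogue P K f a b es c)"
proof -
  have "(THE c. \<exists>es. dialogue P K f a b es c) = c" if "dialogue P K f a b es c" for es c
    using that assms unfolding standard_codings_def
    by (intro the_equality) (auto intro: dialogue_unique)
  then show ?thesis unfolding adjoin_def by auto
qed

text \<open>The partial function deciding equality; its domain consists of the codes of pairs.\<close>

definition eq_fun :: "('a, 'm) applicative_scheme \<Rightarrow> ('a, 'n) codings_scheme \<Rightarrow> 'a \<Rightarrow> 'a option" where
  "eq_fun P K x =
     (if \<exists>a\<in>carrier P. \<exists>b\<in>carrier P. x = pair K a b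
      then Some (if \<exists>a\<in>carrier P. x = pair K a a then tru K else fls K) else None)"

lemma eq_fun_pair:
  assumes "standard_codings P K" "a \<in> carrier P" "b \<in> carrier P"
  shows "eq_fun P K (pair K a b) = Some (if a = b then tru K else fls K)"
  using assms pair_inject[of P K a b] unfolding eq_fun_def standard_codings_def by auto


section \<open>Recursive and recursively enumerable sets\<close>

text \<open>Descriptions of the partial recursive functions. Arities are not part of the syntax:
  on argument lists of any fixed length a description denotes a partial recursive function
  (superfluous arguments are ignored, missing ones make the value undefined).\<close>

datatype recf = Zero | Succ | Proj nat | Comp recf "recf list" | PrimRec recf recf | Minim recf

inductive eval :: "recf \<Rightarrow> nat list \<Rightarrow> nat \<Rightarrow> bool" where
  Zero: "eval Zero xs 0"
| Succ: "eval Succ (x # xs) (Suc x)"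
| Proj: "i < length xs \<Longrightarrow> eval (Proj i) xs (xs ! i)"
| Comp: "list_all2 (\<lambda>g y. eval g xs y) gs ys \<Longrightarrow> eval f ys z \<Longrightarrow> eval (Comp f gs) xs z"
| PrimRec_0: "eval f xs y \<Longrightarrow> eval (PrimRec f g) (0 # xs) y"
| PrimRec_Suc: "eval (PrimRec f g) (n # xs) r \<Longrightarrow> eval g (n # r # xs) y \<Longrightarrow>
    eval (PrimRec f g) (Suc n # xs) y"
| Minim: "eval f (n # xs) 0 \<Longrightarrow> (\<And>m. m < n \<Longrightarrow> \<exists>y. eval f (m # xs) (Suc y)) \<Longrightarrow>
    eval (Minim f) xs n"

inductive_cases eval_ZeroE: "eval Zero xs y"
inductive_cases eval_SuccE: "eval Succ xs y"
inductive_cases eval_ProjE: "eval (Proj i) xs y"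
inductive_cases eval_CompE: "eval (Comp f gs) xs y"
inductive_cases eval_PrimRec_0E: "eval (PrimRec f g) (0 # xs) y"
inductive_cases eval_PrimRec_SucE: "eval (PrimRec f g) (Suc n # xs) y"
inductive_cases eval_MinimE: "eval (Minim f) xs y"

lemma eval_deterministic: "eval f xs y \<Longrightarrow> eval f xs z \<Longrightarrow> y = z"
proof (induction f xs y arbitrary: z rule: eval.induct)
  case (Zero xs)
  then show ?case by (elim eval_ZeroE) simp
next
  case (Succ x xs)
  then show ?case by (elim eval_SuccE) simp
next
  case (Proj i xs)
  from Proj.prems show ?case by (elim eval_ProjE) simp
next
  case (Comp xs gs ys f w)
  from Comp.prems obtain ys' where ys': "list_all2 (\<lambda>g y. eval g xs y) gs ys'" "eval f ys' z"
    by (elim eval_CompE) blast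
  have "ys = ys'"
    using Comp.IH(1) ys'(1) by (auto simp: list_all2_conv_all_nth intro!: nth_equalityI)
  then show ?case using Comp.IH(2) ys'(2) by blast
next
  case (PrimRec_0 f xs y g)
  from PrimRec_0.prems show ?case by (elim eval_PrimRec_0E) (rule PrimRec_0.IH)
next
  case (PrimRec_Suc f g n xs r y)
  from PrimRec_Suc.prems obtain r' where "eval (PrimRec f g) (n # xs) r'" "eval g (n # r' # xs) z"
    by (elim eval_PrimRec_SucE) blast
  then show ?case using PrimRec_Suc.IH by blast
next
  case (Minim f n xs)
  from Minim.prems have z: "eval f (z # xs) 0" "\<And>m. m < z \<Longrightarrow> \<exists>y. eval f (m # xs) (Suc y)"
    by (elim eval_MinimE; blast)+
  have "\<not> z < n" using Minim.IH(2) z(1) by blast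
  moreover have "\<not> n < z" using Minim.IH(1) z(2) by blast
  ultimately show ?case by simp
qed

definition recursively_enumerable :: "nat set \<Rightarrow> bool" where
  "recursively_enumerable A \<longleftrightarrow> (\<exists>f. \<forall>x. x \<in> A \<longleftrightarrow> (\<exists>y. eval f [x] y))"

definition recursive :: "nat set \<Rightarrow> bool" where
  "recursive A \<longleftrightarrow> (\<exists>f. \<forall>x. eval f [x] (if x \<in> A then 1 else 0))"


section \<open>Scott's graph model\<close>

text \<open>\<^const>\<open>prod_encode\<close> is the Cantor pairing, and \<open>set_decode m\<close> is the finite set \<open>p\<close> with
  \<open>m = (\<Sum>i\<in>p. 2 ^ i)\<close>.\<close>

definition graph_app :: "nat set \<Rightarrow> nat set \<Rightarrow> nat set" where
  "graph_app A B = {n. \<exists>m. prod_encode (m, n) \<in> A \<and> set_decode m \<subseteq> B}"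

definition graph_model :: "nat set applicative" where
  "graph_model = \<lparr>carrier = UNIV, app = (\<lambda>A B. Some (graph_app A B))\<rparr>"

definition RE :: "nat set applicative" where
  "RE = graph_model\<lparr>carrier := {A. recursively_enumerable A}\<rparr>"

definition complement_fun :: "nat set \<Rightarrow> nat set option" where
  "complement_fun A = (if recursive A then Some (- A) else None)"

end

theory Submission
  imports Defs
begin

text \<open>If \<open>W\<^sub>0, W\<^sub>1, \<dots>\<close> is a uniform enumeration of all r.e. sets, then for recursive \<open>A\<close> the complement is
  \<open>W\<^sub>i\<close> for the least \<open>i\<close> with \<open>A \<union> W\<^sub>i = \<nat>\<close> and \<open>A \<inter> W\<^sub>i = \<emptyset>\<close>. Union and intersection are enumeration
  operators, so both conditions are one query to \<open>Eq\<close>: the disjoint sum of \<open>A \<union> W\<^sub>i\<close> and \<open>A \<inter> W\<^sub>i\<close>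
  is compared with that of \<open>\<nat>\<close> and \<open>\<emptyset>\<close>. The dialogue asks this for \<open>i = 0, 1, \<dots>\<close> until the answer is
  \<open>T\<close> and then returns \<open>W\<^sub>i\<close>. That such an element exists in \<open>RE\<close> is obtained from closure properties
  of the enumeration operators whose graph is r.e., including closure under least fixed points,
  which also yields the universal r.e. set from the evaluation rules of the recursive functions.\<close>

section \<open>Computable functions\<close>

text \<open>Total functions of \<open>k\<close> arguments are taken as functions on lists, so that
  composition is stated once for every arity. The arity 3 is that of the step functions of primitive
  recursion.\<close>

definition recn :: "nat \<Rightarrow> (nat list \<Rightarrow> nat) \<Rightarrow> bool" where
  "recn k F \<longleftrightarrow> (\<exists>r. \<forall>xs. length xs = k \<longrightarrow> eval r xs (F xs))"

definition computable :: "(nat \<Rightarrow> nat) \<Rightarrow> bool" where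
  "computable f \<longleftrightarrow> recn 1 (\<lambda>xs. f (xs ! 0))"

definition computable2 :: "(nat \<Rightarrow> nat \<Rightarrow> nat) \<Rightarrow> bool" where
  "computable2 f \<longleftrightarrow> recn 2 (\<lambda>xs. f (xs ! 0) (xs ! 1))"

lemma recn_nth: "i < k \<Longrightarrow> recn k (\<lambda>xs. xs ! i)"
  unfolding recn_def by (auto intro: eval.Proj)

lemma recn_zero: "recn k (\<lambda>xs. 0)"
  unfolding recn_def by (auto intro: eval.Zero)

lemma recn_computable:
  assumes "computable h" "recn k F"
  shows "recn k (\<lambda>xs. h (F xs))"
proof -
  obtain r s where rs: "\<And>xs. length xs = 1 \<Longrightarrow> eval r xs (h (xs ! 0))"
    "\<And>xs. length xs = k \<Longrightarrow> eval s xs (F xs)"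
    using assms unfolding computable_def recn_def by blast
  have "eval (Comp r [s]) xs (h (F xs))" if "length xs = k" for xs
    using rs(1)[of "[F xs]"] rs(2)[OF that] by (intro eval.Comp[where ys = "[F xs]"]) auto
  then show ?thesis unfolding recn_def by blast
qed

lemma recn_computable2:
  assumes "computable2 h" "recn k F" "recn k G"
  shows "recn k (\<lambda>xs. h (F xs) (G xs))"
proof -
  obtain r s t where rs: "\<And>xs. length xs = 2 \<Longrightarrow> eval r xs (h (xs ! 0) (xs ! 1))"
    "\<And>xs. length xs = k \<Longrightarrow> eval s xs (F xs)" "\<And>xs. length xs = k \<Longrightarrow> eval t xs (G xs)"
    using assms unfolding computable2_def recn_def by blast
  have "eval (Comp r [s, t]) xs (h (F xs) (G xs))" if "length xs = k" for xs
    using rs(1)[of "[F xs, G xs]"] rs(2,3)[OF that]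
    by (intro eval.Comp[where ys = "[F xs, G xs]"]) auto
  then show ?thesis unfolding recn_def by blast
qed

lemma computable_id: "computable (\<lambda>x. x)"
  unfolding computable_def by (rule recn_nth) simp

lemma computable_compose1: "computable h \<Longrightarrow> computable f \<Longrightarrow> computable (\<lambda>x. h (f x))"
  unfolding computable_def[of f] computable_def[of "\<lambda>x. h (f x)"] by (rule recn_computable)

lemma computable_compose2:
  "computable2 h \<Longrightarrow> computable f \<Longrightarrow> computable g \<Longrightarrow> computable (\<lambda>x. h (f x) (g x))"
  unfolding computable_def by (rule recn_computable2)

lemma computable2_swap:
  assumes "computable2 h" shows "computable2 (\<lambda>x y. h y x)"
  unfolding computable2_def by (rule recn_computable2[OF assms]) (rule recn_nth, simp)+

lemma computable_SucI: "computable f \<Longrightarrow> computable (\<lambda>x. Suc (f x))"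
proof (rule computable_compose1[of Suc])
  have "eval Succ xs (Suc (xs ! 0))" if "length xs = 1" for xs
    using that by (cases xs) (auto intro: eval.Succ)
  then show "computable Suc" unfolding computable_def recn_def by blast
qed

lemma computable_const: "computable (\<lambda>x. c)"
proof (induction c)
  case 0
  then show ?case unfolding computable_def by (rule recn_zero)
next
  case (Suc c)
  then show ?case by (rule computable_SucI)
qed

lemma computable2_primrec:
  assumes a: "computable a" and g: "recn 3 g"
    and F: "\<And>x. F 0 x = a x" "\<And>n x. F (Suc n) x = g [n, F n x, x]"
  shows "computable2 F"
proof -
  obtain r s where rs: "\<And>xs. length xs = 1 \<Longrightarrow> eval r xs (a (xs ! 0))"
    "\<And>xs. length xs = 3 \<Longrightarrow> eval s xs (g xs)"
    using a g unfolding computable_def recn_def by blast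
  have "eval (PrimRec r s) [n, x] (F n x)" for n x
  proof (induction n)
    case 0
    then show ?case using rs(1)[of "[x]"] by (auto intro: eval.PrimRec_0 simp: F)
  next
    case (Suc n)
    then show ?case using rs(2)[of "[n, F n x, x]"] by (auto intro: eval.PrimRec_Suc simp: F)
  qed
  then have "eval (PrimRec r s) xs (F (xs ! 0) (xs ! 1))" if "length xs = 2" for xs
    using that by (auto simp: length_Suc_conv numeral_2_eq_2)
  then show ?thesis unfolding computable2_def recn_def by blast
qed

lemma computable_primrec:
  assumes "recn 3 g" "F 0 = c" "\<And>n. F (Suc n) = g [n, F n, 0]"
  shows "computable F"
proof -
  \<comment> \<open>A dummy parameter is added and afterwards set to 0. The recursion equation of
    \<open>F\<close> is available for the parameter 0 only, so for other parameters
    \<open>rec_nat\<close> supplies a function obeying the scheme.\<close>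
  have "computable2 (\<lambda>n x. if x = 0 then F n else (rec_nat c (\<lambda>n r. g [n, r, x]) n))"
    by (rule computable2_primrec[OF computable_const[of c] assms(1)]) (simp_all add: assms)
  from computable_compose2[OF this computable_id computable_const[of 0]] show ?thesis by simp
qed

lemma computable2_add: "computable2 (\<lambda>n x. n + x)"
  by (rule computable2_primrec[OF computable_id, where g = "\<lambda>xs. Suc (xs ! 1)"])
    (auto intro!: recn_computable[of Suc] recn_nth computable_SucI[OF computable_id])

lemmas computable_add = computable_compose2[OF computable2_add]
lemmas recn_add = recn_computable2[OF computable2_add]

lemma computable2_mult: "computable2 (\<lambda>n x. n * x)"
  by (rule computable2_primrec[OF computable_const, where g = "\<lambda>xs. xs ! 1 + xs ! 2"])
    (auto intro!: recn_add recn_nth)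

lemmas computable_mult = computable_compose2[OF computable2_mult]

lemma computable2_diff: "computable2 (\<lambda>x y. x - y)"
proof (rule computable2_swap)
  have pred: "computable (\<lambda>n. n - Suc 0)"
    by (rule computable_primrec[where g = "\<lambda>xs. xs ! 0"]) (auto intro: recn_nth)
  \<comment> \<open>The recursion runs along the subtrahend and iterates the predecessor; hence the
    swap of arguments.\<close>
  show "computable2 (\<lambda>n x. x - n)"
    by (rule computable2_primrec[OF computable_id, where g = "\<lambda>xs. xs ! 1 - Suc 0"])
      (auto intro!: recn_computable[OF pred] recn_nth)
qed

lemmas computable_diff = computable_compose2[OF computable2_diff]

lemma computable_power2:
  assumes "computable f" shows "computable (\<lambda>x. 2 ^ f x)"
proof (rule computable_compose1[OF _ assms])
  show "computable (\<lambda>n. 2 ^ n)"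
    by (rule computable_primrec[where g = "\<lambda>xs. xs ! 1 + xs ! 1"])
      (auto intro!: recn_add recn_nth)
qed

lemma computable_triangle:
  assumes "computable f" shows "computable (\<lambda>x. triangle (f x))"
proof (rule computable_compose1[OF _ assms])
  show "computable triangle"
    by (rule computable_primrec[where g = "\<lambda>xs. xs ! 1 + Suc (xs ! 0)"])
      (auto intro!: recn_add recn_nth recn_computable[OF computable_SucI[OF computable_id]])
qed

lemma computable2_prod_encode: "computable2 (\<lambda>x y. prod_encode (x, y))"
  unfolding computable2_def prod_encode_def case_prod_conv
  by (intro recn_add recn_nth recn_computable[OF computable_triangle[OF computable_id]]) auto

lemmas computable_prod_encode = computable_compose2[OF computable2_prod_encode]

lemma computable2_least:
  assumes c: "computable2 c" and ex: "\<And>x. \<exists>n. c n x = 0"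
  shows "computable (\<lambda>x. LEAST n. c n x = 0)"
proof -
  obtain r where r: "\<And>xs. length xs = 2 \<Longrightarrow> eval r xs (c (xs ! 0) (xs ! 1))"
    using c unfolding computable2_def recn_def by blast
  have "eval (Minim r) [x] (LEAST n. c n x = 0)" for x
  proof (rule eval.Minim)
    show "eval r [LEAST n. c n x = 0, x] 0"
      using r[of "[LEAST n. c n x = 0, x]"] LeastI_ex[OF ex[of x]] by simp
    show "\<exists>y. eval r [m, x] (Suc y)" if "m < (LEAST n. c n x = 0)" for m
      using r[of "[m, x]"] not_less_Least[OF that] by (cases "c m x") auto
  qed
  then have "eval (Minim r) xs (LEAST n. c n (xs ! 0) = 0)" if "length xs = 1" for xs
    using that by (auto simp: length_Suc_conv)
  then show ?thesis unfolding computable_def recn_def by blast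
qed

section \<open>Computable projections of the pairing\<close>

definition pfst :: "nat \<Rightarrow> nat" where "pfst z = fst (prod_decode z)"
definition psnd :: "nat \<Rightarrow> nat" where "psnd z = snd (prod_decode z)"

lemma pfst_encode [simp]: "pfst (prod_encode (m, n)) = m"
  and psnd_encode [simp]: "psnd (prod_encode (m, n)) = n"
  by (simp_all add: pfst_def psnd_def)

lemma prod_encode_collapse [simp]: "prod_encode (pfst z, psnd z) = z"
  by (simp add: pfst_def psnd_def)

lemma triangle_mono: "m \<le> n \<Longrightarrow> triangle m \<le> triangle n"
  by (induction n rule: dec_induct) auto

text \<open>The Cantor code of \<open>(m, n)\<close> is \<open>triangle (m + n) + m\<close>, which
  lies below \<open>triangle (Suc (m + n))\<close>. Hence the sum of the components of
  \<open>z\<close> is found by searching for the least \<open>w\<close> with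
  \<open>z < triangle (Suc w)\<close>; truncated subtraction turns this inequality into an equation
  with 0.\<close>

lemma computable_pair_sum: "computable (\<lambda>z. pfst z + psnd z)"
proof -
  have eq: "(LEAST w. Suc z - triangle (Suc w) = 0) = pfst z + psnd z" for z
  proof (rule Least_equality)
    have z: "z = triangle (pfst z + psnd z) + pfst z"
      using prod_encode_collapse[of z] by (simp only: prod_encode_def case_prod_conv)
    show "Suc z - triangle (Suc (pfst z + psnd z)) = 0"
      by (subst (1) z) simp
    show "pfst z + psnd z \<le> w" if "Suc z - triangle (Suc w) = 0" for w
    proof (rule ccontr)
      assume "\<not> pfst z + psnd z \<le> w"
      then have "triangle (Suc w) \<le> triangle (pfst z + psnd z)" by (intro triangle_mono) simp
      then show False using that z by linarith
    qed
  qed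
  have tri: "recn 2 (\<lambda>xs. triangle (Suc (xs ! 0)))"
    by (intro recn_computable[of "\<lambda>n. triangle (Suc n)"] recn_nth computable_triangle
        computable_SucI computable_id) simp
  have "computable (\<lambda>z. LEAST w. Suc z - triangle (Suc w) = 0)"
  proof (rule computable2_least)
    show "computable2 (\<lambda>w z. Suc z - triangle (Suc w))"
      unfolding computable2_def
      by (rule recn_computable2[OF computable2_diff _ tri])
        (intro recn_computable[of Suc] recn_nth computable_SucI computable_id, simp)
    show "\<exists>w. Suc z - triangle (Suc w) = 0" for z
      by (rule exI[of _ z]) simp
  qed
  then show ?thesis by (simp only: eq)
qed

lemma computable_pfst: assumes "computable f" shows "computable (\<lambda>x. pfst (f x))"
proof (rule computable_compose1[OF _ assms])
  have "pfst z = z - triangle (pfst z + psnd z)" for z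
  proof -
    have "z = triangle (pfst z + psnd z) + pfst z"
      using prod_encode_collapse[of z] by (simp only: prod_encode_def case_prod_conv)
    then show ?thesis by linarith
  qed
  then have "pfst = (\<lambda>z. z - triangle (pfst z + psnd z))" by blast
  moreover have "computable (\<lambda>z. z - triangle (pfst z + psnd z))"
    by (intro computable_diff computable_triangle computable_pair_sum computable_id)
  ultimately show "computable pfst" by simp
qed

lemma computable_psnd: assumes "computable f" shows "computable (\<lambda>x. psnd (f x))"
proof (rule computable_compose1[OF _ assms])
  have "psnd = (\<lambda>z. (pfst z + psnd z) - pfst z)" by auto
  moreover have "computable (\<lambda>z. (pfst z + psnd z) - pfst z)"
    by (intro computable_diff computable_pfst computable_pair_sum computable_id)
  ultimately show "computable psnd" by simp
qed

lemmas computable_intros =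
  computable_id computable_const computable_SucI computable_add computable_mult computable_diff
  computable_power2 computable_prod_encode computable_pfst computable_psnd

section \<open>Decidable predicates\<close>

definition decidable :: "(nat \<Rightarrow> bool) \<Rightarrow> bool" where
  "decidable P \<longleftrightarrow> computable (\<lambda>x. of_bool (P x))"

lemma decidable_subst: "decidable P \<Longrightarrow> computable f \<Longrightarrow> decidable (\<lambda>x. P (f x))"
  unfolding decidable_def by (rule computable_compose1)

lemma decidable_not:
  assumes "decidable P" shows "decidable (\<lambda>x. \<not> P x)"
proof -
  have "(\<lambda>x. of_bool (\<not> P x)) = (\<lambda>x. 1 - of_bool (P x) :: nat)" by auto
  then show ?thesis
    using assms unfolding decidable_def by (simp add: computable_diff computable_const)
qed

lemma decidable_conj: "decidable P \<Longrightarrow> decidable Q \<Longrightarrow> decidable (\<lambda>x. P x \<and> Q x)"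
  unfolding decidable_def of_bool_conj by (intro computable_intros)

lemma decidable_disj: "decidable P \<Longrightarrow> decidable Q \<Longrightarrow> decidable (\<lambda>x. P x \<or> Q x)"
  using decidable_not[of "\<lambda>x. \<not> P x \<and> \<not> Q x"]
  by (simp add: decidable_conj decidable_not)

lemma decidable_imp: "decidable P \<Longrightarrow> decidable Q \<Longrightarrow> decidable (\<lambda>x. P x \<longrightarrow> Q x)"
  unfolding imp_conv_disj by (intro decidable_disj decidable_not)

lemma decidable_le: "computable f \<Longrightarrow> computable g \<Longrightarrow> decidable (\<lambda>x. f x \<le> g x)"
proof -
  assume fg: "computable f" "computable g"
  have "(\<lambda>x. of_bool (f x \<le> g x)) = (\<lambda>x. 1 - (f x - g x))" by auto
  then show ?thesis unfolding decidable_def using fg by (simp only:) (intro computable_diff computable_const)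
qed

lemma decidable_less: "computable f \<Longrightarrow> computable g \<Longrightarrow> decidable (\<lambda>x. f x < g x)"
  using decidable_not[of "\<lambda>x. g x \<le> f x"] by (simp add: not_le decidable_le)

lemma decidable_eq: "computable f \<Longrightarrow> computable g \<Longrightarrow> decidable (\<lambda>x. f x = g x)"
  unfolding eq_iff[where 'a = nat] by (intro decidable_conj decidable_le)

text \<open>Bounded search is a primitive recursion on the bound, where
  \<open>1 - (1 - a) * (1 - b)\<close> is the disjunction of truth values. The hypothesis packs two
  arguments into one number, the quantified variable first and the parameter second; the quantifier
  rules for \<open>effective\<close> and the definition of \<open>eff_set\<close> follow the same
  convention.\<close>

lemma decidable_bex:
  assumes P: "decidable (\<lambda>z. P (psnd z) (pfst z))" and b: "computable b"
  shows "decidable (\<lambda>x. \<exists>i<b x. P x i)"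
proof -
  have or: "computable (\<lambda>z. 1 - (1 - pfst z) * (1 - psnd z))" by (intro computable_intros)
  have P': "computable (\<lambda>z. of_bool (P (psnd z) (pfst z)))"
    using P unfolding decidable_def .
  let ?P = "\<lambda>xs. of_bool (P (psnd (prod_encode (xs ! 0, xs ! 2))) (pfst (prod_encode (xs ! 0, xs ! 2))))"
  have "recn 3 (\<lambda>xs. prod_encode (xs ! 1, ?P xs))"
    by (intro recn_computable2[OF computable2_prod_encode] recn_nth recn_computable[OF P']) auto
  from recn_computable[OF or this] have g: "recn 3 (\<lambda>xs. 1 - (1 - xs ! 1) * (1 - ?P xs))"
    by simp
  have "computable2 (\<lambda>n x. of_bool (\<exists>i<n. P x i))"
    by (rule computable2_primrec[OF computable_const[of 0] g]) (auto simp: less_Suc_eq)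
  from computable_compose2[OF this b computable_id] show ?thesis unfolding decidable_def .
qed

lemma decidable_ball:
  assumes "decidable (\<lambda>z. P (psnd z) (pfst z))" and "computable b"
  shows "decidable (\<lambda>x. \<forall>i<b x. P x i)"
proof -
  have "decidable (\<lambda>x. \<not> (\<exists>i<b x. \<not> P x i))"
    by (intro decidable_not decidable_bex assms)
  then show ?thesis by simp
qed

text \<open>Membership in \<open>set_decode m\<close> is defined by the left-hand side. Division
  with remainder replaces it by bounded quantifiers over sums, products and powers of 2, for which
  decidability is established.\<close>

lemma odd_div_iff:
  "odd (m div 2 ^ i) \<longleftrightarrow> (\<exists>q<Suc m. \<exists>r<2 ^ i. m = (q + q + 1) * 2 ^ i + r)" for m i :: nat
proof
  assume "odd (m div 2 ^ i)"
  then obtain q where q: "m div 2 ^ i = 2 * q + 1" by (auto elim: oddE)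
  have "m = (q + q + 1) * 2 ^ i + m mod 2 ^ i"
    using div_mult_mod_eq[of m "2 ^ i"] q by (simp add: mult_2)
  moreover have "q < Suc m" using q div_le_dividend[of m "2 ^ i"] by linarith
  ultimately show "\<exists>q<Suc m. \<exists>r<2 ^ i. m = (q + q + 1) * 2 ^ i + r"
    using mod_less_divisor[of "2 ^ i" m] by (metis zero_less_numeral zero_less_power)
next
  assume "\<exists>q<Suc m. \<exists>r<2 ^ i. m = (q + q + 1) * 2 ^ i + r"
  then obtain q r where "r < 2 ^ i" "m = (q + q + 1) * 2 ^ i + r" by blast
  then have "m div 2 ^ i = q + q + 1" by (simp only: div_mult_self3) auto
  then show "odd (m div 2 ^ i)" by simp
qed

lemma decidable_mem_set_decode:
  assumes "computable f" "computable g"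
  shows "decidable (\<lambda>x. f x \<in> set_decode (g x))"
  unfolding set_decode_def mem_Collect_eq odd_div_iff
  by (intro decidable_bex decidable_eq computable_intros computable_compose1[OF assms(1)]
      computable_compose1[OF assms(2)])

lemmas decidable_intros =
  decidable_not decidable_conj decidable_disj decidable_imp decidable_le decidable_less
  decidable_eq decidable_bex decidable_ball decidable_mem_set_decode

text \<open>Since \<open>i < 2 ^ i \<le> m\<close>, a quantifier over a coded finite set can be
  bounded by its code.\<close>

lemma set_decode_less: "i \<in> set_decode m \<Longrightarrow> i < m"
proof -
  assume "i \<in> set_decode m"
  then have "m div 2 ^ i \<noteq> 0" unfolding set_decode_def by (auto intro: ccontr)
  then have "2 ^ i \<le> m" by (simp add: div_eq_0_iff)
  then show "i < m" using less_exp[of i] by linarith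
qed

section \<open>Effective enumeration operators\<close>

text \<open>The witness \<open>t\<close> packs the finite part of \<open>X\<close> that is consulted with the remaining search data.\<close>

definition effective :: "(nat set \<Rightarrow> nat \<Rightarrow> bool) \<Rightarrow> bool" where
  "effective \<Phi> \<longleftrightarrow> (\<exists>D. decidable (\<lambda>z. D (pfst z) (psnd z)) \<and>
     (\<forall>X n. \<Phi> X n \<longleftrightarrow> (\<exists>t. D t n \<and> set_decode (pfst t) \<subseteq> X)))"

lemma effectiveE:
  assumes "effective \<Phi>"
  obtains D where "\<And>f g. computable f \<Longrightarrow> computable g \<Longrightarrow> decidable (\<lambda>x. D (f x) (g x))"
    and "\<And>X n. \<Phi> X n \<longleftrightarrow> (\<exists>t. D t n \<and> set_decode (pfst t) \<subseteq> X)"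
proof -
  obtain D where D: "decidable (\<lambda>z. D (pfst z) (psnd z))"
    "\<And>X n. \<Phi> X n \<longleftrightarrow> (\<exists>t. D t n \<and> set_decode (pfst t) \<subseteq> X)"
    using assms unfolding effective_def by blast
  have "decidable (\<lambda>x. D (f x) (g x))" if "computable f" "computable g" for f g
    using decidable_subst[OF D(1) computable_prod_encode[OF that]] by simp
  then show ?thesis using D(2) by (rule that)
qed

lemma effectiveI:
  assumes D: "decidable (\<lambda>z. D (pfst (pfst z)) (psnd (pfst z)) (psnd z))"
    and "\<And>X n. \<Phi> X n \<longleftrightarrow> (\<exists>m s. D m s n \<and> set_decode m \<subseteq> X)"
  shows "effective \<Phi>"
  unfolding effective_def using assms
  by (intro exI[of _ "\<lambda>t. D (pfst t) (psnd t)"] conjI) (auto, metis pfst_encode psnd_encode)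

lemma effective_mono:
  assumes "effective \<Phi>" "X \<subseteq> Y" "\<Phi> X n" shows "\<Phi> Y n"
  using assms unfolding effective_def by (metis order_trans)

lemma effective_finite:
  assumes "effective \<Phi>" "\<Phi> X n"
  obtains F where "finite F" "F \<subseteq> X" "\<Phi> F n"
proof -
  obtain D where D: "\<And>X n. \<Phi> X n \<longleftrightarrow> (\<exists>t. D t n \<and> set_decode (pfst t) \<subseteq> X)"
    using assms(1) unfolding effective_def by metis
  obtain t where t: "D t n" "set_decode (pfst t) \<subseteq> X" using assms(2) unfolding D by blast
  from t(1) have "\<Phi> (set_decode (pfst t)) n" unfolding D by blast
  with t(2) show ?thesis using that[OF finite_set_decode] by blast
qed

lemma decidable_subset:
  assumes "computable f" "computable g"
  shows "decidable (\<lambda>x. set_decode (f x) \<subseteq> set_decode (g x))"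
proof -
  have "decidable (\<lambda>x. \<forall>i<f x. i \<in> set_decode (f x) \<longrightarrow> i \<in> set_decode (g x))"
    by (intro decidable_ball decidable_imp decidable_mem_set_decode computable_intros
        computable_compose1[OF assms(1)] computable_compose1[OF assms(2)] assms(1))
  moreover have "(\<forall>i<f x. i \<in> set_decode (f x) \<longrightarrow> i \<in> set_decode (g x)) \<longleftrightarrow>
      set_decode (f x) \<subseteq> set_decode (g x)" for x
    using set_decode_less by blast
  ultimately show ?thesis by simp
qed

section \<open>Closure properties of effective operators\<close>

lemma effective_decidable:
  assumes "decidable P" shows "effective (\<lambda>X n. P n)"
proof (rule effectiveI)
  show "decidable (\<lambda>z. P (psnd z))" by (intro decidable_subst[OF assms] computable_intros)
  show "P n \<longleftrightarrow> (\<exists>m (s :: nat). P n \<and> set_decode m \<subseteq> X)" for X n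
    by (auto intro: exI[of _ 0])
qed

lemma effective_mem_arg:
  assumes "computable f" shows "effective (\<lambda>X n. f n \<in> X)"
proof (rule effectiveI)
  show "decidable (\<lambda>z. f (psnd z) \<in> set_decode (pfst (pfst z)))"
    by (intro decidable_mem_set_decode computable_compose1[OF assms] computable_intros)
  show "f n \<in> X \<longleftrightarrow> (\<exists>m (s :: nat). f n \<in> set_decode m \<and> set_decode m \<subseteq> X)" for X n
    using set_encode_inverse[of "{f n}"] by (metis empty_subsetI finite.intros insert_subset insertI1 subsetD)
qed

lemma effective_conj:
  assumes "effective \<Phi>" "effective \<Psi>" shows "effective (\<lambda>X n. \<Phi> X n \<and> \<Psi> X n)"
proof -
  obtain D where D: "\<And>f g. computable f \<Longrightarrow> computable g \<Longrightarrow> decidable (\<lambda>x. D (f x) (g x))"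
    "\<And>X n. \<Phi> X n \<longleftrightarrow> (\<exists>t. D t n \<and> set_decode (pfst t) \<subseteq> X)" using effectiveE[OF assms(1)] by blast
  obtain E where E: "\<And>f g. computable f \<Longrightarrow> computable g \<Longrightarrow> decidable (\<lambda>x. E (f x) (g x))"
    "\<And>X n. \<Psi> X n \<longleftrightarrow> (\<exists>t. E t n \<and> set_decode (pfst t) \<subseteq> X)" using effectiveE[OF assms(2)] by blast
  \<comment> \<open>\<open>s\<close> codes a pair of witnesses, and \<open>m\<close> codes a finite
    set containing the parts of the input that both consult; their union is such a set.\<close>
  let ?D = "\<lambda>m s n. D (pfst s) n \<and> E (psnd s) n \<and>
    set_decode (pfst (pfst s)) \<subseteq> set_decode m \<and> set_decode (pfst (psnd s)) \<subseteq> set_decode m"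
  show ?thesis
  proof (rule effectiveI[of ?D])
    show "decidable (\<lambda>z. ?D (pfst (pfst z)) (psnd (pfst z)) (psnd z))"
      by (intro decidable_conj decidable_subset D(1) E(1) computable_intros)
    fix X n
    show "\<Phi> X n \<and> \<Psi> X n \<longleftrightarrow> (\<exists>m s. ?D m s n \<and> set_decode m \<subseteq> X)"
    proof
      assume "\<Phi> X n \<and> \<Psi> X n"
      then obtain t u where "D t n" "set_decode (pfst t) \<subseteq> X" "E u n" "set_decode (pfst u) \<subseteq> X"
        unfolding D(2) E(2) by blast
      then show "\<exists>m s. ?D m s n \<and> set_decode m \<subseteq> X"
        by (intro exI[of _ "set_encode (set_decode (pfst t) \<union> set_decode (pfst u))"]
            exI[of _ "prod_encode (t, u)"]) auto
    next
      assume "\<exists>m s. ?D m s n \<and> set_decode m \<subseteq> X"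
      then show "\<Phi> X n \<and> \<Psi> X n" unfolding D(2) E(2) by (meson order_trans)
    qed
  qed
qed

lemma effective_disj:
  assumes "effective \<Phi>" "effective \<Psi>" shows "effective (\<lambda>X n. \<Phi> X n \<or> \<Psi> X n)"
proof -
  obtain D where D: "\<And>f g. computable f \<Longrightarrow> computable g \<Longrightarrow> decidable (\<lambda>x. D (f x) (g x))"
    "\<And>X n. \<Phi> X n \<longleftrightarrow> (\<exists>t. D t n \<and> set_decode (pfst t) \<subseteq> X)" using effectiveE[OF assms(1)] by blast
  obtain E where E: "\<And>f g. computable f \<Longrightarrow> computable g \<Longrightarrow> decidable (\<lambda>x. E (f x) (g x))"
    "\<And>X n. \<Psi> X n \<longleftrightarrow> (\<exists>t. E t n \<and> set_decode (pfst t) \<subseteq> X)" using effectiveE[OF assms(2)] by blast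
  have "decidable (\<lambda>z. D (pfst z) (psnd z) \<or> E (pfst z) (psnd z))"
    by (intro decidable_disj D(1) E(1) computable_intros)
  then show ?thesis
    unfolding effective_def D(2) E(2) by (intro exI[of _ "\<lambda>t n. D t n \<or> E t n"]) blast
qed

lemma effective_subst:
  assumes "effective \<Phi>" "computable f" shows "effective (\<lambda>X n. \<Phi> X (f n))"
proof -
  obtain D where D: "\<And>f g. computable f \<Longrightarrow> computable g \<Longrightarrow> decidable (\<lambda>x. D (f x) (g x))"
    "\<And>X n. \<Phi> X n \<longleftrightarrow> (\<exists>t. D t n \<and> set_decode (pfst t) \<subseteq> X)" using effectiveE[OF assms(1)] by blast
  have "decidable (\<lambda>z. D (pfst z) (f (psnd z)))"
    by (intro D(1) computable_compose1[OF assms(2)] computable_intros)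
  then show ?thesis unfolding effective_def D(2) by (intro exI[of _ "\<lambda>t n. D t (f n)"]) blast
qed

lemma effective_ex:
  assumes "effective (\<lambda>X z. \<Phi> X (psnd z) (pfst z))"
  shows "effective (\<lambda>X n. \<exists>k. \<Phi> X n k)"
proof -
  obtain D where D: "\<And>f g. computable f \<Longrightarrow> computable g \<Longrightarrow> decidable (\<lambda>x. D (f x) (g x))"
    "\<And>X z. \<Phi> X (psnd z) (pfst z) \<longleftrightarrow> (\<exists>t. D t z \<and> set_decode (pfst t) \<subseteq> X)"
    using effectiveE[OF assms] by blast
  let ?D = "\<lambda>m s n. D (pfst s) (prod_encode (psnd s, n)) \<and> set_decode (pfst (pfst s)) \<subseteq> set_decode m"
  show ?thesis
  proof (rule effectiveI[of ?D])
    show "decidable (\<lambda>z. ?D (pfst (pfst z)) (psnd (pfst z)) (psnd z))"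
      by (intro decidable_conj decidable_subset D(1) computable_intros)
    fix X n
    have \<Phi>: "\<Phi> X n k \<longleftrightarrow> (\<exists>t. D t (prod_encode (k, n)) \<and> set_decode (pfst t) \<subseteq> X)" for k
      using D(2)[of X "prod_encode (k, n)"] by simp
    show "(\<exists>k. \<Phi> X n k) \<longleftrightarrow> (\<exists>m s. ?D m s n \<and> set_decode m \<subseteq> X)"
    proof
      assume "\<exists>k. \<Phi> X n k"
      then obtain k t where "D t (prod_encode (k, n))" "set_decode (pfst t) \<subseteq> X"
        unfolding \<Phi> by blast
      then show "\<exists>m s. ?D m s n \<and> set_decode m \<subseteq> X"
        by (intro exI[of _ "pfst t"] exI[of _ "prod_encode (t, k)"]) auto
    next
      assume "\<exists>m s. ?D m s n \<and> set_decode m \<subseteq> X"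
      then show "\<exists>k. \<Phi> X n k" unfolding \<Phi> by (meson order_trans)
    qed
  qed
qed

lemma effective_ball:
  assumes "effective (\<lambda>X z. \<Phi> X (psnd z) (pfst z))" and b: "computable b"
  shows "effective (\<lambda>X n. \<forall>k<b n. \<Phi> X n k)"
proof -
  obtain D where D: "\<And>f g. computable f \<Longrightarrow> computable g \<Longrightarrow> decidable (\<lambda>x. D (f x) (g x))"
    "\<And>X z. \<Phi> X (psnd z) (pfst z) \<longleftrightarrow> (\<exists>t. D t z \<and> set_decode (pfst t) \<subseteq> X)"
    using effectiveE[OF assms(1)] by blast
  \<comment> \<open>One number \<open>s\<close> bounds the witnesses for all \<open>k\<close>, so no
    sequence of witnesses has to be coded. The set coded by \<open>m\<close> contains all finite
    parts they consult.\<close>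
  let ?D = "\<lambda>m s n. \<forall>k<b n. \<exists>t<s. D t (prod_encode (k, n)) \<and> set_decode (pfst t) \<subseteq> set_decode m"
  show ?thesis
  proof (rule effectiveI[of ?D])
    show "decidable (\<lambda>z. ?D (pfst (pfst z)) (psnd (pfst z)) (psnd z))"
      by (intro decidable_ball decidable_bex decidable_conj decidable_subset D(1) computable_intros
          computable_compose1[OF b])
    fix X n
    have \<Phi>: "\<Phi> X n k \<longleftrightarrow> (\<exists>t. D t (prod_encode (k, n)) \<and> set_decode (pfst t) \<subseteq> X)" for k
      using D(2)[of X "prod_encode (k, n)"] by simp
    show "(\<forall>k<b n. \<Phi> X n k) \<longleftrightarrow> (\<exists>m s. ?D m s n \<and> set_decode m \<subseteq> X)"
    proof
      assume "\<forall>k<b n. \<Phi> X n k"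
      then have "\<forall>k<b n. \<exists>t. D t (prod_encode (k, n)) \<and> set_decode (pfst t) \<subseteq> X" unfolding \<Phi> .
      then obtain t where t: "\<And>k. k < b n \<Longrightarrow> D (t k) (prod_encode (k, n))"
        "\<And>k. k < b n \<Longrightarrow> set_decode (pfst (t k)) \<subseteq> X" by metis
      let ?M = "\<Union>k<b n. set_decode (pfst (t k))"
      have fin: "finite ?M" by simp
      have less: "t k < Suc (\<Sum>k<b n. t k)" if "k < b n" for k
        using member_le_sum[of k "{..<b n}" t] that by (simp add: less_Suc_eq_le)
      have "?D (set_encode ?M) (Suc (\<Sum>k<b n. t k)) n"
        using t(1) less unfolding set_encode_inverse[OF fin] by blast
      moreover have "set_decode (set_encode ?M) \<subseteq> X"
        using t(2) unfolding set_encode_inverse[OF fin] by blast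
      ultimately show "\<exists>m s. ?D m s n \<and> set_decode m \<subseteq> X" by blast
    next
      assume "\<exists>m s. ?D m s n \<and> set_decode m \<subseteq> X"
      then show "\<forall>k<b n. \<Phi> X n k" unfolding \<Phi> by (meson order_trans)
    qed
  qed
qed

lemma effective_eq: "computable f \<Longrightarrow> computable g \<Longrightarrow> effective (\<lambda>X n. f n = g n)"
  by (intro effective_decidable decidable_eq)

lemma effective_neq: "computable f \<Longrightarrow> computable g \<Longrightarrow> effective (\<lambda>X n. f n \<noteq> g n)"
  by (intro effective_decidable decidable_not decidable_eq)

lemma effective_False: "effective (\<lambda>X n. False)"
  using effective_neq[OF computable_const[of 0] computable_const[of 0]] by simp

lemma effective_subset:
  assumes "effective (\<lambda>X z. \<Phi> X (psnd z) (pfst z))" and f: "computable f"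
  shows "effective (\<lambda>X n. set_decode (f n) \<subseteq> {i. \<Phi> X n i})"
proof -
  have "effective (\<lambda>X n. \<forall>i<f n. i \<notin> set_decode (f n) \<or> \<Phi> X n i)"
    by (intro effective_ball effective_disj effective_decidable decidable_not
        decidable_mem_set_decode computable_intros computable_compose1[OF f] assms)
  moreover have "(\<forall>i<f n. i \<notin> set_decode (f n) \<or> \<Phi> X n i) \<longleftrightarrow> set_decode (f n) \<subseteq> {i. \<Phi> X n i}"
    for X n using set_decode_less by blast
  ultimately show ?thesis by simp
qed

text \<open>A witness for \<open>\<Phi>\<close> consults a finite set only, so the inner operator
  has to produce finitely many elements, which is a bounded universal condition.\<close>

lemma effective_compose:
  assumes "effective \<Phi>" "effective (\<lambda>X z. \<Psi> X (psnd z) (pfst z))" "computable f"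
  shows "effective (\<lambda>X n. \<Phi> {i. \<Psi> X n i} (f n))"
proof -
  obtain D where D: "\<And>f g. computable f \<Longrightarrow> computable g \<Longrightarrow> decidable (\<lambda>x. D (f x) (g x))"
    "\<And>X n. \<Phi> X n \<longleftrightarrow> (\<exists>t. D t n \<and> set_decode (pfst t) \<subseteq> X)" using effectiveE[OF assms(1)] by blast
  \<comment> \<open>Below the quantifier over the witness, the parameter \<open>n\<close> sits one
    pairing level deeper.\<close>
  have *: "effective (\<lambda>X z. \<Psi> X (psnd (psnd z)) (pfst z))"
    using effective_subst[OF assms(2), of "\<lambda>z. prod_encode (pfst z, psnd (psnd z))"]
    by (simp add: computable_prod_encode computable_pfst computable_psnd computable_id)
  show ?thesis unfolding D(2)
    by (intro effective_ex effective_conj effective_subset effective_decidable D(1) *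
        computable_intros computable_compose1[OF assms(3)])
qed

text \<open>Membership in the least fixed point is witnessed by a finite set of pairs \<open>(u, n)\<close>, read as
  ``\<open>n\<close> is derived at time \<open>u\<close>'', in which every derivation only uses earlier ones.\<close>

lemma effective_lfp:
  assumes \<Psi>: "effective \<Psi>" and \<Theta>: "effective \<Theta>"
  shows "effective (\<lambda>X n. n \<in> lfp (\<lambda>Y. {n. \<Theta> X n \<or> \<Psi> Y n}))"
proof -
  let ?before = "\<lambda>E u. {j. \<exists>v<u. prod_encode (v, j) \<in> E}"
  define good where "good X E \<longleftrightarrow> (\<forall>z\<in>E. \<Theta> X (psnd z) \<or> \<Psi> (?before E (pfst z)) (psnd z))" for X E
  have mono: "mono (\<lambda>Y. {n. \<Theta> X n \<or> \<Psi> Y n})" for X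
    by (rule monoI) (auto intro: effective_mono[OF \<Psi>])
  have sound: "n \<in> lfp (\<lambda>Y. {n. \<Theta> X n \<or> \<Psi> Y n})" if "good X E" "prod_encode (u, n) \<in> E" for X E u n
    using that(2)
  proof (induction u arbitrary: n rule: less_induct)
    case (less u)
    have "\<Theta> X n \<or> \<Psi> (?before E u) n"
      using that(1) less.prems unfolding good_def by fastforce
    moreover have "?before E u \<subseteq> lfp (\<lambda>Y. {n. \<Theta> X n \<or> \<Psi> Y n})" using less.IH by blast
    ultimately show ?case
      using effective_mono[OF \<Psi>] by (subst lfp_unfold[OF mono]) blast
  qed
  \<comment> \<open>Justifications survive in larger sets because \<open>\<Psi>\<close> is monotone;
    this is what allows certificates to be united.\<close>
  have good_mono: "\<Theta> X (psnd z) \<or> \<Psi> (?before E' (pfst z)) (psnd z)"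
    if "good X E" "E \<subseteq> E'" "z \<in> E" for X E E' z
  proof -
    have "?before E (pfst z) \<subseteq> ?before E' (pfst z)" using that(2) by blast
    then show ?thesis using that effective_mono[OF \<Psi>] unfolding good_def by blast
  qed
  \<comment> \<open>The elements that have a finite good certificate form a set closed under the
    operator: \<open>\<Psi>\<close> consults finitely many of them, and their certificates together
    with one new pair form a certificate.\<close>
  have "lfp (\<lambda>Y. {n. \<Theta> X n \<or> \<Psi> Y n}) \<subseteq> {n. \<exists>E u. finite E \<and> good X E \<and> prod_encode (u, n) \<in> E}"
    (is "_ \<subseteq> ?S") for X
  proof (rule lfp_lowerbound, intro subsetI, elim CollectE disjE)
    fix n assume "\<Theta> X n"
    then have "good X {prod_encode (0, n)}" unfolding good_def by simp
    then show "n \<in> ?S" by blast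
  next
    fix n assume "\<Psi> ?S n"
    then obtain F where F: "finite F" "F \<subseteq> ?S" "\<Psi> F n"
      using effective_finite[OF \<Psi>] by blast
    then obtain E u where E: "\<And>j. j \<in> F \<Longrightarrow> finite (E j)" "\<And>j. j \<in> F \<Longrightarrow> good X (E j)"
      "\<And>j. j \<in> F \<Longrightarrow> prod_encode (u j, j) \<in> E j"
    proof -
      have "\<forall>j\<in>F. \<exists>E u. finite E \<and> good X E \<and> prod_encode (u, j) \<in> E" using F(2) by blast
      then show ?thesis using that by metis
    qed
    \<comment> \<open>This time exceeds every \<open>u j\<close>, so that all consulted elements
      count as earlier.\<close>
    let ?u = "Suc (sum u F)"
    let ?E = "insert (prod_encode (?u, n)) (\<Union>j\<in>F. E j)"
    have "F \<subseteq> ?before ?E ?u"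
    proof
      fix j assume "j \<in> F"
      then have "u j < ?u" using member_le_sum[of j F u] F(1) by (simp add: less_Suc_eq_le)
      then show "j \<in> ?before ?E ?u" using E(3) \<open>j \<in> F\<close> by blast
    qed
    then have "\<Psi> (?before ?E ?u) n" using effective_mono[OF \<Psi> _ F(3)] by blast
    moreover have "\<Theta> X (psnd z) \<or> \<Psi> (?before ?E (pfst z)) (psnd z)" if "j \<in> F" "z \<in> E j" for j z
      using good_mono[OF E(2)[OF that(1)] _ that(2), of ?E] that by blast
    ultimately have "good X ?E" unfolding good_def by auto
    moreover have "finite ?E" using F(1) E(1) by blast
    ultimately show "n \<in> ?S" by blast
  qed
  then have lfp: "n \<in> lfp (\<lambda>Y. {n. \<Theta> X n \<or> \<Psi> Y n}) \<longleftrightarrow>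
      (\<exists>E u. finite E \<and> good X E \<and> prod_encode (u, n) \<in> E)" for X n
    using sound by blast
  have ball: "good X (set_decode d) \<longleftrightarrow> (\<forall>z<d. z \<notin> set_decode d \<or> \<Theta> X (psnd z) \<or>
      \<Psi> {j. \<exists>v<pfst z. prod_encode (v, j) \<in> set_decode d} (psnd z))" for X d
    unfolding good_def using set_decode_less by blast
  \<comment> \<open>Certificates are replaced by their codes, so that the existence of one becomes a
    quantifier over numbers.\<close>
  have "n \<in> lfp (\<lambda>Y. {n. \<Theta> X n \<or> \<Psi> Y n}) \<longleftrightarrow>
      (\<exists>d. good X (set_decode d) \<and> (\<exists>u. prod_encode (u, n) \<in> set_decode d))" for X n
    unfolding lfp by (metis finite_set_decode set_encode_inverse)
  moreover have "effective (\<lambda>X n. \<exists>d. good X (set_decode d) \<and> (\<exists>u. prod_encode (u, n) \<in> set_decode d))"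
    unfolding ball
    by (intro effective_ex effective_conj effective_disj effective_ball
        effective_compose[OF \<Psi>] effective_subst[OF \<Theta>]
        effective_decidable decidable_intros computable_intros)
  ultimately show ?thesis by simp
qed

section \<open>Effective families of sets\<close>

definition eff_set :: "(nat set \<Rightarrow> nat \<Rightarrow> nat set) \<Rightarrow> bool" where
  "eff_set F \<longleftrightarrow> effective (\<lambda>X z. pfst z \<in> F X (psnd z))"

lemma eff_set_Collect:
  "effective (\<lambda>X z. \<Phi> X (psnd z) (pfst z)) \<Longrightarrow> eff_set (\<lambda>X x. {n. \<Phi> X x n})"
  unfolding eff_set_def by simp

lemma eff_set_arg: "eff_set (\<lambda>X x. X)"
  unfolding eff_set_def by (intro effective_mem_arg computable_intros)

lemma eff_set_subst:
  assumes "eff_set F" "computable f" shows "eff_set (\<lambda>X x. F X (f x))"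
  using effective_subst[OF assms(1)[unfolded eff_set_def], of "\<lambda>z. prod_encode (pfst z, f (psnd z))"]
    assms(2) unfolding eff_set_def
  by (simp add: computable_prod_encode computable_pfst computable_psnd computable_id
      computable_compose1[OF assms(2)])

lemma effective_mem:
  assumes "eff_set F" "computable f" shows "effective (\<lambda>X x. f x \<in> F X x)"
  using effective_subst[OF assms(1)[unfolded eff_set_def], of "\<lambda>x. prod_encode (f x, x)"] assms(2)
  by (simp add: computable_prod_encode computable_id)

lemma eff_set_compose:
  assumes "eff_set F" "eff_set G" "computable f" shows "eff_set (\<lambda>X x. F (G X x) (f x))"
proof -
  have "effective (\<lambda>X z. pfst z \<in> F {i. i \<in> G X (psnd z)} (f (psnd z)))"
    using effective_compose[OF assms(1)[unfolded eff_set_def],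
        of "\<lambda>X z i. i \<in> G X (psnd z)" "\<lambda>z. prod_encode (pfst z, f (psnd z))"]
      effective_subst[OF assms(2)[unfolded eff_set_def], of "\<lambda>z. prod_encode (pfst z, psnd (psnd z))"]
    by (simp add: computable_prod_encode computable_pfst computable_psnd computable_id
      computable_compose1[OF assms(3)])
  then show ?thesis unfolding eff_set_def by simp
qed

text \<open>With this rule every applicative term over r.e. constants, the argument and effective
  families is again an effective family, so elements of \<open>RE\<close> can be specified by terms
  without explicit combinators.\<close>

lemma eff_set_app:
  assumes "eff_set F" "eff_set G" shows "eff_set (\<lambda>X x. graph_app (F X x) (G X x))"
proof -
  have "effective (\<lambda>X z. \<exists>m. prod_encode (m, pfst z) \<in> F X (psnd z) \<and>
      set_decode m \<subseteq> {i. i \<in> G X (psnd z)})"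
    by (intro effective_ex effective_conj effective_subset effective_mem eff_set_subst[OF assms(1)]
        eff_set_subst[OF assms(2)] computable_intros)
  then show ?thesis unfolding eff_set_def graph_app_def by simp
qed

section \<open>Recursively enumerable sets\<close>

text \<open>Viewing a set as a constant operator makes the closure rules for
  \<open>effective\<close> available; the notion is later shown to coincide with
  \<open>recursively_enumerable\<close>.\<close>

definition sigma1 :: "nat set \<Rightarrow> bool" where
  "sigma1 S \<longleftrightarrow> effective (\<lambda>X n. n \<in> S)"

lemma eff_set_sigma1: "sigma1 S \<Longrightarrow> eff_set (\<lambda>X x. S)"
  unfolding sigma1_def eff_set_def by (erule effective_subst) (intro computable_intros)

lemma sigma1_eff_set:
  assumes "eff_set F" "sigma1 A" shows "sigma1 (F A x)"
proof -
  have "eff_set (\<lambda>X n. F A x)"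
    using eff_set_compose[OF assms(1) eff_set_sigma1[OF assms(2)] computable_const[of x]] .
  then show ?thesis unfolding sigma1_def by (intro effective_mem computable_intros)
qed

lemma sigma1_imp_re:
  assumes "sigma1 S" shows "recursively_enumerable S"
proof -
  obtain D where D: "\<And>f g. computable f \<Longrightarrow> computable g \<Longrightarrow> decidable (\<lambda>x. D (f x) (g x))"
    "\<And>X n. n \<in> S \<longleftrightarrow> (\<exists>t. D t n \<and> set_decode (pfst t) \<subseteq> X)"
    using effectiveE[OF assms[unfolded sigma1_def]] by blast
  \<comment> \<open>The operator is constant, so the input may be chosen as \<open>UNIV\<close>,
    which makes the inclusion condition trivial.\<close>
  have S: "n \<in> S \<longleftrightarrow> (\<exists>t. D t n)" for n using D(2)[of n UNIV] by simp
  \<comment> \<open>\<open>Minim\<close> searches for the value 0, so the truth value is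
    negated.\<close>
  have c: "computable (\<lambda>z. of_bool (\<not> D (pfst z) (psnd z)))"
    using decidable_not[OF D(1)[of pfst psnd]] computable_pfst[OF computable_id]
      computable_psnd[OF computable_id] unfolding decidable_def by simp
  have "recn 2 (\<lambda>xs. prod_encode (xs ! 0, xs ! 1))"
    using computable2_prod_encode unfolding computable2_def .
  from recn_computable[OF c this]
  obtain r where r: "eval r xs (of_bool (\<not> D (xs ! 0) (xs ! 1)))" if "length xs = 2" for xs
    unfolding recn_def by auto
  have r': "eval r [t, n] (of_bool (\<not> D t n))" for t n using r[of "[t, n]"] by simp
  have "n \<in> S \<longleftrightarrow> (\<exists>t. eval (Minim r) [n] t)" for n
  proof
    assume "n \<in> S"
    then have ex: "\<exists>t. D t n" by (simp add: S)
    have "eval (Minim r) [n] (LEAST t. D t n)"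
    proof (rule eval.Minim)
      show "eval r [LEAST t. D t n, n] 0" using r'[of "LEAST t. D t n" n] LeastI_ex[OF ex] by simp
      show "\<exists>y. eval r [m, n] (Suc y)" if "m < (LEAST t. D t n)" for m
        using r'[of m n] not_less_Least[OF that] by auto
    qed
    then show "\<exists>t. eval (Minim r) [n] t" ..
  next
    assume "\<exists>t. eval (Minim r) [n] t"
    then obtain t where "eval r [t, n] 0" by (auto elim: eval_MinimE)
    then have "D t n" using eval_deterministic[OF r'[of t n]] by (cases "D t n") auto
    then show "n \<in> S" using S by blast
  qed
  then show ?thesis unfolding recursively_enumerable_def by blast
qed

text \<open>The element is the graph of the operator: it contains the code of \<open>(m, n)\<close>
  when some witness consulting exactly the finite set coded by \<open>m\<close> establishes
  \<open>n\<close>.\<close>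

lemma effective_representable:
  assumes "effective \<Phi>"
  obtains a where "sigma1 a" "\<And>X. graph_app a X = {n. \<Phi> X n}"
proof -
  obtain D where D: "\<And>f g. computable f \<Longrightarrow> computable g \<Longrightarrow> decidable (\<lambda>x. D (f x) (g x))"
    "\<And>X n. \<Phi> X n \<longleftrightarrow> (\<exists>t. D t n \<and> set_decode (pfst t) \<subseteq> X)"
    using effectiveE[OF assms] by blast
  let ?a = "{z. \<exists>s. D (prod_encode (pfst z, s)) (psnd z)}"
  have "sigma1 ?a" unfolding sigma1_def mem_Collect_eq
    by (intro effective_ex effective_decidable D(1) computable_intros)
  moreover
  have "graph_app ?a X = {n. \<Phi> X n}" for X
  proof -
    have "(\<exists>m. (\<exists>s. D (prod_encode (m, s)) n) \<and> set_decode m \<subseteq> X) \<longleftrightarrow>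
        (\<exists>t. D t n \<and> set_decode (pfst t) \<subseteq> X)" for n
      by (metis pfst_encode prod_encode_collapse)
    then show ?thesis unfolding graph_app_def D(2) by simp
  qed
  ultimately show ?thesis by (rule that)
qed

section \<open>A universal enumerable relation\<close>

primrec code :: "recf \<Rightarrow> nat" where
  "code Zero = prod_encode (0, 0)"
| "code Succ = prod_encode (1, 0)"
| "code (Proj i) = prod_encode (2, i)"
| "code (Comp f gs) = prod_encode (3, prod_encode (code f, list_encode (map code gs)))"
| "code (PrimRec f g) = prod_encode (4, prod_encode (code f, code g))"
| "code (Minim f) = prod_encode (5, code f)"

definition judgement :: "nat \<Rightarrow> nat \<Rightarrow> nat \<Rightarrow> nat \<Rightarrow> nat" where
  "judgement k a b c = prod_encode (k, prod_encode (a, prod_encode (b, c)))"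

lemma judgement_eq_iff [simp]:
  "judgement k a b c = judgement k' a' b' c' \<longleftrightarrow> k = k' \<and> a = a' \<and> b = b' \<and> c = c'"
  by (auto simp: judgement_def)

text \<open>This is how \<open>list_encode\<close> codes a nonempty list; 0 codes the empty
  one.\<close>

abbreviation cons :: "nat \<Rightarrow> nat \<Rightarrow> nat" where
  "cons x l \<equiv> Suc (prod_encode (x, l))"

text \<open>The evaluation rules on codes. Judgement 0 states \<open>eval f xs y\<close>, judgement 1 states
  \<open>list_all2 (\<lambda>g y. eval g xs y) gs ys\<close>, and judgement 2 states that \<open>f\<close> is positive below \<open>n\<close>;
  the latter two turn the unboundedly many premises of composition and minimization into finitely many.\<close>

definition eval_step :: "nat set \<Rightarrow> nat \<Rightarrow> bool" where
  "eval_step Y z \<longleftrightarrow>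
    (\<exists>l. z = judgement 0 (prod_encode (0, 0)) l 0) \<or>
    (\<exists>x l. z = judgement 0 (prod_encode (1, 0)) (cons x l) (Suc x)) \<or>
    (\<exists>x l. z = judgement 0 (prod_encode (2, 0)) (cons x l) x) \<or>
    (\<exists>i x l y. z = judgement 0 (prod_encode (2, Suc i)) (cons x l) y \<and>
       judgement 0 (prod_encode (2, i)) l y \<in> Y) \<or>
    (\<exists>f gs l ys y. z = judgement 0 (prod_encode (3, prod_encode (f, gs))) l y \<and>
       judgement 1 gs l ys \<in> Y \<and> judgement 0 f ys y \<in> Y) \<or>
    (\<exists>l. z = judgement 1 0 l 0) \<or>
    (\<exists>g gs l y ys. z = judgement 1 (cons g gs) l (cons y ys) \<and>
       judgement 0 g l y \<in> Y \<and> judgement 1 gs l ys \<in> Y) \<or>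
    (\<exists>f g l y. z = judgement 0 (prod_encode (4, prod_encode (f, g))) (cons 0 l) y \<and>
       judgement 0 f l y \<in> Y) \<or>
    (\<exists>f g n l r y. z = judgement 0 (prod_encode (4, prod_encode (f, g))) (cons (Suc n) l) y \<and>
       judgement 0 (prod_encode (4, prod_encode (f, g))) (cons n l) r \<in> Y \<and>
       judgement 0 g (cons n (cons r l)) y \<in> Y) \<or>
    (\<exists>f n l. z = judgement 0 (prod_encode (5, f)) l n \<and>
       judgement 0 f (cons n l) 0 \<in> Y \<and> judgement 2 f n l \<in> Y) \<or>
    (\<exists>f l. z = judgement 2 f 0 l) \<or>
    (\<exists>f n l y. z = judgement 2 f (Suc n) l \<and> judgement 2 f n l \<in> Y \<and>
       judgement 0 f (cons n l) (Suc y) \<in> Y)"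

text \<open>The disjunct \<open>False\<close> is an empty seed that gives the fixed point the form
  treated by \<open>effective_lfp\<close>.\<close>

definition derivable :: "nat set" where
  "derivable = lfp (\<lambda>Y. {z. False \<or> eval_step Y z})"

lemma effective_eval_step: "effective eval_step"
  unfolding eval_step_def[abs_def] judgement_def
  by (intro effective_disj effective_ex effective_conj effective_eq effective_mem_arg
      computable_intros)

lemma sigma1_derivable: "sigma1 derivable"
  unfolding sigma1_def derivable_def
  by (rule effective_lfp[OF effective_eval_step effective_False])

lemma mono_eval_step: "mono (\<lambda>Y. {z. False \<or> eval_step Y z})"
  by (rule monoI) (auto intro: effective_mono[OF effective_eval_step])

lemma derivable_iff: "z \<in> derivable \<longleftrightarrow> eval_step derivable z"
  unfolding derivable_def by (subst lfp_unfold[OF mono_eval_step]) simp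

text \<open>Completeness of the rules on codes, by induction on the evaluation. Inner inductions
  peel the list for projections and build the auxiliary judgements for composition and
  minimization.\<close>

lemma derivable_evaluates:
  "eval f xs y \<Longrightarrow> judgement 0 (code f) (list_encode xs) y \<in> derivable"
proof (induction f xs y rule: eval.induct)
  case (Zero xs)
  show ?case by (subst derivable_iff) (simp add: eval_step_def)
next
  case (Succ x xs)
  show ?case by (subst derivable_iff) (simp add: eval_step_def)
next
  case (Proj i xs)
  then show ?case
  proof (induction i arbitrary: xs)
    case 0
    then show ?case by (subst derivable_iff) (cases xs; simp add: eval_step_def)
  next
    case (Suc i)
    then obtain x xs' where "xs = x # xs'" by (cases xs) auto
    then show ?case using Suc
      by (subst derivable_iff) (simp add: eval_step_def)
  qed
next
  case (Comp xs gs ys f z)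
  have "judgement 1 (list_encode (map code gs)) (list_encode xs) (list_encode ys) \<in> derivable"
    using Comp.IH(1)
  proof (induction rule: list_all2_induct)
    case Nil
    show ?case by (subst derivable_iff) (simp add: eval_step_def)
  next
    case (Cons g gs y ys)
    then show ?case by (subst derivable_iff) (simp add: eval_step_def)
  qed
  then show ?case using Comp.IH(2)
    by (subst derivable_iff) (auto simp: eval_step_def)
next
  case (PrimRec_0 f xs y g)
  then show ?case by (subst derivable_iff) (simp add: eval_step_def)
next
  case (PrimRec_Suc f g n xs r y)
  then show ?case by (subst derivable_iff) (auto simp: eval_step_def)
next
  case (Minim f n xs)
  have "judgement 2 (code f) m (list_encode xs) \<in> derivable" if "m \<le> n" for m
    using that
  proof (induction m)
    case 0
    show ?case by (subst derivable_iff) (simp add: eval_step_def)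
  next
    case (Suc m)
    then obtain y where "judgement 0 (code f) (list_encode (m # xs)) (Suc y) \<in> derivable"
      using Minim.IH(2)[of m] by auto
    then show ?case using Suc by (subst derivable_iff) (auto simp: eval_step_def)
  qed
  then show ?case using Minim.IH(1)
    by (subst derivable_iff) (auto simp: eval_step_def)
qed

section \<open>Soundness of the coded evaluation rules\<close>

lemma inj_code: "code f = code g \<Longrightarrow> f = g"
proof (induction f arbitrary: g)
  case (Comp f fs)
  then obtain h hs where g: "g = recf.Comp h hs" by (cases g) auto
  then have "code f = code h" "map code fs = map code hs"
    using Comp.prems by (auto simp: list_encode_eq)
  then show ?case using Comp.IH g by (metis list.inj_map_strong)
next
  case (PrimRec f1 f2)
  then show ?case by (cases g) auto
next
  case (Minim f)
  then show ?case by (cases g) auto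
next
  case Zero
  then show ?case by (cases g) auto
next
  case Succ
  then show ?case by (cases g) auto
next
  case (Proj i)
  then show ?case by (cases g) auto
qed

text \<open>The intended meaning of the judgements, serving as the invariant of a fixed point
  induction. It is vacuous for numbers that do not code a judgement about actual
  descriptions.\<close>

definition valid :: "nat \<Rightarrow> bool" where
  "valid z \<longleftrightarrow>
    (\<forall>f xs y. z = judgement 0 (code f) (list_encode xs) y \<longrightarrow> eval f xs y) \<and>
    (\<forall>gs xs ys. z = judgement 1 (list_encode (map code gs)) (list_encode xs) (list_encode ys) \<longrightarrow>
       list_all2 (\<lambda>g y. eval g xs y) gs ys) \<and>
    (\<forall>f n xs. z = judgement 2 (code f) n (list_encode xs) \<longrightarrow>
       (\<forall>m<n. \<exists>y. eval f (m # xs) (Suc y)))"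

lemma valid_0: "valid (judgement 0 (code f) (list_encode xs) y) \<longleftrightarrow> eval f xs y"
  unfolding valid_def by (auto simp: list_encode_eq dest: inj_code)

lemma valid_1: "valid (judgement 1 (list_encode (map code gs)) (list_encode xs) (list_encode ys))
    \<longleftrightarrow> list_all2 (\<lambda>g y. eval g xs y) gs ys"
  unfolding valid_def by (auto simp: list_encode_eq dest: map_injective[OF _ injI[OF inj_code]])

lemma valid_2: "valid (judgement 2 (code f) n (list_encode xs)) \<longleftrightarrow>
    (\<forall>m<n. \<exists>y. eval f (m # xs) (Suc y))"
  unfolding valid_def by (auto simp: list_encode_eq dest: inj_code)

text \<open>The shape of \<open>f\<close> determines which coded rule was applied. Its premises are
  valid, and validity unfolds to the premises of the matching rule of \<open>eval\<close>.\<close>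

lemma eval_step_sound:
  assumes "eval_step {z. valid z} z" "z = judgement 0 (code f) (list_encode xs) y"
  shows "eval f xs y"
proof (cases f)
  case Zero
  then show ?thesis using assms by (simp add: eval_step_def) (rule eval.Zero)
next
  case Succ
  then show ?thesis using assms
    by (cases xs) (auto simp: eval_step_def intro: eval.Succ)
next
  case (Proj i)
  show ?thesis
  proof (cases xs)
    case Nil
    then show ?thesis using assms Proj by (auto simp: eval_step_def)
  next
    case (Cons x xs')
    show ?thesis
    proof (cases i)
      case 0
      then show ?thesis using assms Proj Cons eval.Proj[of 0 xs]
        by (auto simp: eval_step_def)
    next
      case (Suc j)
      then have "eval (recf.Proj j) xs' y"
        using assms Proj Cons valid_0[of "recf.Proj j" xs' y]
        by (auto simp: eval_step_def)
      then show ?thesis using eval.Proj[of i xs] Proj Cons Suc by (auto elim!: eval_ProjE)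
    qed
  qed
next
  case (Comp g gs)
  then obtain l where "valid (judgement 1 (list_encode (map code gs)) (list_encode xs) l)"
    "valid (judgement 0 (code g) l y)"
    using assms by (auto simp: eval_step_def)
  \<comment> \<open>The coded rule provides a mere number \<open>l\<close>; every number codes some
    list.\<close>
  moreover obtain ys where "l = list_encode ys" by (metis list_decode_inverse)
  ultimately have "list_all2 (\<lambda>g y. eval g xs y) gs ys" "eval g ys y"
    by (simp_all only: valid_0 valid_1)
  then show ?thesis using Comp by (auto intro: eval.Comp)
next
  case (PrimRec g h)
  show ?thesis
  proof (cases xs)
    case Nil
    then show ?thesis using assms PrimRec by (auto simp: eval_step_def)
  next
    case (Cons n xs')
    show ?thesis
    proof (cases n)
      case 0
      then show ?thesis using assms PrimRec Cons
        by (auto simp: eval_step_def valid_0 intro: eval.PrimRec_0)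
    next
      case (Suc m)
      then obtain r where
        "valid (judgement 0 (code (recf.PrimRec g h)) (list_encode (m # xs')) r)"
        "valid (judgement 0 (code h) (list_encode (m # r # xs')) y)"
        using assms PrimRec Cons by (auto simp: eval_step_def)
      then show ?thesis using PrimRec Cons Suc unfolding valid_0 by (auto intro: eval.PrimRec_Suc)
    qed
  qed
next
  case (Minim g)
  then have "valid (judgement 0 (code g) (list_encode (y # xs)) 0)"
    "valid (judgement 2 (code g) y (list_encode xs))"
    using assms by (auto simp: eval_step_def)
  then show ?thesis using Minim unfolding valid_0 valid_2 by (auto intro: eval.Minim)
qed

text \<open>Fixed point induction: the set of valid numbers is closed under the rules.\<close>

lemma derivable_valid: "z \<in> derivable \<Longrightarrow> valid z"
proof -
  have "valid z" if step: "eval_step {z. valid z} z" for z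
    unfolding valid_def
  proof (intro conjI allI impI)
    show "eval f xs y" if "z = judgement 0 (code f) (list_encode xs) y" for f xs y
      using step that by (rule eval_step_sound)
    show "list_all2 (\<lambda>g y. eval g xs y) gs ys"
      if z: "z = judgement 1 (list_encode (map code gs)) (list_encode xs) (list_encode ys)" for gs xs ys
    proof (cases gs)
      case Nil
      then show ?thesis using step z by (cases ys) (auto simp: eval_step_def)
    next
      case (Cons g gs')
      then obtain y ys' where ys: "ys = y # ys'"
        using step z by (cases ys) (auto simp: eval_step_def)
      then have "valid (judgement 0 (code g) (list_encode xs) y)"
        "valid (judgement 1 (list_encode (map code gs')) (list_encode xs) (list_encode ys'))"
        using step z Cons by (auto simp: eval_step_def)
      then show ?thesis using Cons ys by (simp only: valid_0 valid_1 list_all2_Cons)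
    qed
    show "\<exists>y. eval f (m # xs) (Suc y)"
      if z: "z = judgement 2 (code f) n (list_encode xs)" and m: "m < n" for f n xs m
    proof (cases n)
      case (Suc k)
      then obtain y where "valid (judgement 0 (code f) (list_encode (k # xs)) (Suc y))"
        "valid (judgement 2 (code f) k (list_encode xs))"
        using step z by (auto simp: eval_step_def)
      then show ?thesis using Suc m unfolding valid_0 valid_2 by (metis less_antisym)
    qed (use m in simp)
  qed
  then have "derivable \<subseteq> {z. valid z}"
    unfolding derivable_def by (intro lfp_lowerbound) auto
  then show "z \<in> derivable \<Longrightarrow> valid z" by blast
qed

lemma derivable_iff_eval:
  "judgement 0 (code f) (list_encode xs) y \<in> derivable \<longleftrightarrow> eval f xs y"
  using derivable_evaluates derivable_valid valid_0 by blast

text \<open>The domain of the unary partial function with code \<open>e\<close>, where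
  \<open>cons n 0\<close> codes the one-element list. A number \<open>e\<close> coding no
  description still yields an r.e. set, so a search may run through all indices.\<close>

definition universal :: "nat \<Rightarrow> nat set" where
  "universal e = {n. \<exists>y. judgement 0 e (cons n 0) y \<in> derivable}"

lemma effective_derivable: "computable f \<Longrightarrow> effective (\<lambda>X n. f n \<in> derivable)"
  using sigma1_derivable unfolding sigma1_def by (rule effective_subst)

lemma eff_set_universal: "eff_set (\<lambda>X e. universal e)"
  unfolding universal_def judgement_def
  by (intro eff_set_Collect effective_ex effective_derivable computable_intros)

lemma recursively_enumerable_iff_sigma1: "recursively_enumerable S \<longleftrightarrow> sigma1 S"
proof
  assume "recursively_enumerable S"
  then obtain f where "\<And>n. n \<in> S \<longleftrightarrow> (\<exists>y. eval f [n] y)"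
    unfolding recursively_enumerable_def by blast
  then have "S = universal (code f)"
    unfolding universal_def using derivable_iff_eval[of f "[_]"] by auto
  then show "sigma1 S"
    using sigma1_eff_set[OF eff_set_universal, of "{}"] effective_False by (simp add: sigma1_def)
qed (rule sigma1_imp_re)

lemma universal_surj:
  assumes "sigma1 S" obtains e where "S = universal e"
proof -
  obtain f where "\<And>n. n \<in> S \<longleftrightarrow> (\<exists>y. eval f [n] y)"
    using sigma1_imp_re[OF assms] unfolding recursively_enumerable_def by blast
  then have "S = universal (code f)"
    unfolding universal_def using derivable_iff_eval[of f "[_]"] by auto
  then show ?thesis by (rule that)
qed

text \<open>Both sets are fibres of the deciding function, and a fibre is r.e. because derivability
  of its judgements is.\<close>

lemma recursive_sigma1:
  assumes "recursive A" shows "sigma1 A" "sigma1 (- A)"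
proof -
  obtain f where f: "\<And>n. eval f [n] (if n \<in> A then 1 else 0)"
    using assms unfolding recursive_def by blast
  have A: "n \<in> A \<longleftrightarrow> eval f [n] 1" "n \<in> - A \<longleftrightarrow> eval f [n] 0" for n
    using f[of n] eval_deterministic[OF f[of n], of 0] eval_deterministic[OF f[of n], of 1]
    by (cases "n \<in> A"; force)+
  have S: "sigma1 {n. eval f [n] y}" for y
    unfolding derivable_iff_eval[symmetric] judgement_def sigma1_def list_encode.simps mem_Collect_eq
    by (intro effective_derivable computable_intros)
  have "A = {n. eval f [n] 1}" "- A = {n. eval f [n] 0}" using A by blast+
  then show "sigma1 A" "sigma1 (- A)" using S by metis+
qed

section \<open>The complement of a recursive set\<close>

text \<open>All iterates are enumerated at once, as codes of pairs \<open>(j, k)\<close> with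
  \<open>k\<close> in the \<open>j\<close>-th iterate: a least fixed point seeded with
  \<open>X\<close> at level 0, where \<open>P\<close> leads from each level to the next.\<close>

lemma eff_set_funpow_graph_app:
  assumes P: "sigma1 P" and "eff_set F" "computable f"
  shows "eff_set (\<lambda>X x. (graph_app P ^^ f x) (F X x))"
proof -
  define \<Psi> where "\<Psi> Y z \<longleftrightarrow> (\<exists>j. pfst z = Suc j \<and> psnd z \<in> graph_app P {i. prod_encode (j, i) \<in> Y})"
    for Y z
  define \<Theta> where "\<Theta> X z \<longleftrightarrow> pfst z = 0 \<and> psnd z \<in> X" for X z
  define I where "I X = lfp (\<lambda>Y. {z. \<Theta> X z \<or> \<Psi> Y z})" for X
  have \<Theta>: "effective \<Theta>" unfolding \<Theta>_def[abs_def]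
    by (intro effective_conj effective_eq effective_mem_arg computable_intros)
  have \<Psi>: "effective \<Psi>" unfolding \<Psi>_def[abs_def]
    by (intro effective_ex effective_conj effective_eq effective_mem effective_mem_arg
        eff_set_app eff_set_sigma1 P eff_set_Collect computable_intros)
  have mono: "mono (\<lambda>Y. {z. \<Theta> X z \<or> \<Psi> Y z})" for X
    by (rule monoI) (auto intro: effective_mono[OF \<Psi>])
  have unfold: "z \<in> I X \<longleftrightarrow> \<Theta> X z \<or> \<Psi> (I X) z" for z X
    unfolding I_def by (subst lfp_unfold[OF mono]) simp
  have I: "{k. prod_encode (j, k) \<in> I X} = (graph_app P ^^ j) X" for j X
  proof (induction j)
    case 0
    then show ?case by (subst unfold) (simp add: \<Theta>_def \<Psi>_def)
  next
    case (Suc j)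
    then show ?case by (subst unfold) (simp add: \<Theta>_def \<Psi>_def)
  qed
  have "effective (\<lambda>X z. prod_encode (psnd z, pfst z) \<in> I X)"
    unfolding I_def by (intro effective_subst[OF effective_lfp[OF \<Psi> \<Theta>]] computable_intros)
  then have "eff_set (\<lambda>X j. (graph_app P ^^ j) X)"
    unfolding eff_set_def I[symmetric] by simp
  from eff_set_compose[OF this assms(2,3)] show ?thesis .
qed

text \<open>Only positive membership conditions occur, which makes this an enumeration operator in
  both arguments, as complementation is not.\<close>

definition join_meet :: "nat set \<Rightarrow> nat set \<Rightarrow> nat set" where
  "join_meet A B = {z. pfst z = 0 \<and> (psnd z \<in> A \<or> psnd z \<in> B) \<or> pfst z \<noteq> 0 \<and> psnd z \<in> A \<and> psnd z \<in> B}"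

lemma join_meet_eq_iff: "join_meet A B = {z. pfst z = 0} \<longleftrightarrow> B = - A"
proof
  assume *: "join_meet A B = {z. pfst z = 0}"
  have "n \<in> B \<longleftrightarrow> n \<notin> A" for n
    using arg_cong[OF *, of "\<lambda>S. prod_encode (0, n) \<in> S"] arg_cong[OF *, of "\<lambda>S. prod_encode (1, n) \<in> S"]
    by (auto simp: join_meet_def)
  then show "B = - A" by blast
qed (auto simp: join_meet_def)

lemma eff_set_join_meet:
  assumes "eff_set F" "eff_set G" shows "eff_set (\<lambda>X x. join_meet (F X x) (G X x))"
  unfolding join_meet_def
  by (intro eff_set_Collect effective_disj effective_conj effective_eq effective_neq effective_mem
      eff_set_subst[OF assms(1)] eff_set_subst[OF assms(2)] computable_intros)

lemma sigma1_eq: "computable f \<Longrightarrow> computable g \<Longrightarrow> sigma1 {n. f n = g n}"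
  unfolding sigma1_def mem_Collect_eq by (rule effective_eq)

lemma sigma1_universal: "sigma1 (universal e)"
  using sigma1_eff_set[OF eff_set_universal, of "{}"] effective_False by (simp add: sigma1_def)

lemma sigma1_join_meet: "sigma1 A \<Longrightarrow> sigma1 B \<Longrightarrow> sigma1 (join_meet A B)"
  using sigma1_eff_set[OF eff_set_join_meet[OF eff_set_sigma1[of A] eff_set_sigma1[of B]], of "{}"]
    effective_False by (simp add: sigma1_def)

lemma carrier_RE [simp]: "A \<in> carrier RE \<longleftrightarrow> sigma1 A"
  by (simp add: RE_def recursively_enumerable_iff_sigma1)

lemma app_RE [simp]: "app RE A B = Some (graph_app A B)"
  by (simp add: RE_def graph_model_def)

abbreviation graph_app_infix (infixl "\<bullet>" 70) where "A \<bullet> B \<equiv> graph_app A B"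

theorem lemma4p1:
  fixes K :: "nat set codings"
  assumes "standard_codings RE K"
  shows "representable (adjoin RE K (eq_fun RE K)) complement_fun"
proof -
  note K = assms[unfolded standard_codings_def]
  let ?T = "tru K" and ?F = "fls K" and ?W = universal and ?E = "{z. pfst z = 0}"
  have TF: "sigma1 ?T" "sigma1 ?F" using K unfolding has_booleans_def by auto
  obtain d where d: "sigma1 d" "\<And>A B. sigma1 A \<Longrightarrow> sigma1 B \<Longrightarrow> d \<bullet> ?T \<bullet> A \<bullet> B = A"
    "\<And>A B. sigma1 A \<Longrightarrow> sigma1 B \<Longrightarrow> d \<bullet> ?F \<bullet> A \<bullet> B = B"
    using K unfolding has_booleans_def by auto
  obtain p where p: "sigma1 p" "\<And>A B. sigma1 A \<Longrightarrow> sigma1 B \<Longrightarrow> p \<bullet> A \<bullet> B = pair K A B"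
    using K unfolding has_pairs_def by auto
  have pair: "sigma1 (pair K A B)" if "sigma1 A" "sigma1 B" for A B
    using K that unfolding has_pairs_def by auto
  have nmrl0: "sigma1 (nmrl K 0)" using K unfolding has_numerals_def by auto
  obtain s where s: "sigma1 s" "\<And>n. s \<bullet> nmrl K n = nmrl K (Suc n)"
    using K unfolding has_numerals_def by auto
  obtain pr where pr: "sigma1 pr" "\<And>n. pr \<bullet> nmrl K (Suc n) = nmrl K n"
    using K unfolding has_numerals_def by auto
  obtain z where z: "sigma1 z" "z \<bullet> nmrl K 0 = ?T" "\<And>n. z \<bullet> nmrl K (Suc n) = ?F"
    using K unfolding has_numerals_def by auto
  obtain l where l: "sigma1 l" "\<And>xs. \<forall>x\<in>set xs. sigma1 x \<Longrightarrow> l \<bullet> tuple K xs = nmrl K (length xs)"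
    using K unfolding has_sequences_def by (auto simp: in_lists_conv_set)
  obtain q where q: "sigma1 q"
    "\<And>xs i. \<forall>x\<in>set xs. sigma1 x \<Longrightarrow> i < length xs \<Longrightarrow> q \<bullet> nmrl K i \<bullet> tuple K xs = xs ! i"
    using K unfolding has_sequences_def by (auto simp: in_lists_conv_set)
  have E: "sigma1 ?E" by (intro sigma1_eq computable_intros)
  have empty: "sigma1 {}" using effective_False by (simp add: sigma1_def)
  have zero: "sigma1 {0}" using sigma1_eq[OF computable_id computable_const[of 0]] by simp

  \<comment> \<open>The codings are arbitrary, so uniformity of the numerals in \<open>n\<close> is
    obtained by iterating the representing element \<open>s\<close>.\<close>
  have nmrl: "(graph_app s ^^ n) (nmrl K 0) = nmrl K n" for n
    by (induction n) (simp_all add: s)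
  have eff_nmrl: "eff_set (\<lambda>X n. nmrl K n)"
    using eff_set_funpow_graph_app[OF s(1) eff_set_sigma1[OF nmrl0] computable_id]
    by (simp only: nmrl)

  \<comment> \<open>The number denoted by the numeral \<open>L\<close> is recovered as the first
    iterate of the predecessor that tests as zero. Case distinction converts an abstract boolean
    into positive information, namely whether 0 is enumerated; the negative test exchanges the two
    cases. Minimality is demanded because the predecessor of 0 is unspecified.\<close>
  define count where "count N L \<longleftrightarrow>
    0 \<in> d \<bullet> (z \<bullet> (graph_app pr ^^ N) L) \<bullet> {0} \<bullet> {} \<and>
    (\<forall>j<N. 0 \<in> d \<bullet> (z \<bullet> (graph_app pr ^^ j) L) \<bullet> {} \<bullet> {0})" for N L
  have count: "count N (nmrl K n) \<longleftrightarrow> N = n" for N n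
  proof -
    have pow: "(graph_app pr ^^ j) (nmrl K n) = nmrl K (n - j)" if "j \<le> n" for j
      using that
    proof (induction j)
      case (Suc j)
      then show ?case using pr(2)[of "n - Suc j"] by (simp add: Suc_diff_Suc)
    qed simp
    have test: "0 \<in> d \<bullet> (z \<bullet> (graph_app pr ^^ j) (nmrl K n)) \<bullet> {0} \<bullet> {} \<longleftrightarrow> j = n"
      "0 \<in> d \<bullet> (z \<bullet> (graph_app pr ^^ j) (nmrl K n)) \<bullet> {} \<bullet> {0} \<longleftrightarrow> j < n" if "j \<le> n" for j
      using that d(2,3)[OF zero empty] d(2,3)[OF empty zero] z(2) z(3)[of "n - Suc j"]
      by (cases "j = n"; simp add: pow Suc_diff_Suc)+
    show ?thesis
    proof (cases "N \<le> n")
      case True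
      then show ?thesis unfolding count_def by (auto simp: test)
    next
      case False
      \<comment> \<open>The iterate with index \<open>n\<close> is the numeral 0 and fails the
        nonzero test.\<close>
      then have "\<not> count N (nmrl K n)" unfolding count_def using test(2)[of n] not_le by blast
      then show ?thesis using False by auto
    qed
  qed

  \<comment> \<open>Entry 0 of the tuple \<open>S\<close> is the input, and the leading
    \<open>?F\<close> marks the value as a query to the oracle.\<close>
  define query where "query i S = p \<bullet> ?F \<bullet> (p \<bullet> join_meet (q \<bullet> nmrl K 0 \<bullet> S) (?W i) \<bullet> ?E)" for i S
  \<comment> \<open>\<open>N\<close> is the length of the tuple. Length 1 means that no answer has
    arrived yet. At length \<open>k + 2\<close> the last entry has index \<open>k + 1\<close> and
    answers the query about \<open>?W k\<close>: on \<open>?T\<close> this set is returned, on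
    \<open>?F\<close> the next query is asked.\<close>
  define \<Phi> where "\<Phi> S x \<longleftrightarrow> (\<exists>N. count N (l \<bullet> S) \<and> (N = 1 \<and> x \<in> query 0 S \<or>
    (\<exists>k. N = Suc (Suc k) \<and>
      x \<in> d \<bullet> (q \<bullet> nmrl K (Suc k) \<bullet> S) \<bullet> (p \<bullet> ?T \<bullet> ?W k) \<bullet> query (Suc k) S)))" for S x
  have eff_query: "eff_set (\<lambda>S x. query (f x) S)" if "computable f" for f
    unfolding query_def
    by (intro eff_set_app eff_set_sigma1 p(1) q(1) TF E eff_set_join_meet nmrl0 eff_set_arg
        eff_set_subst[OF eff_set_universal] that)
  have "effective \<Phi>"
    unfolding \<Phi>_def[abs_def] count_def
    by (intro effective_ex effective_conj effective_disj effective_eq effective_ball effective_mem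
        eff_query eff_set_app eff_set_funpow_graph_app eff_set_sigma1 d(1) z(1) pr(1) l(1) q(1) p(1)
        TF zero empty eff_set_arg eff_set_subst[OF eff_nmrl] eff_set_subst[OF eff_set_universal]
        computable_intros)
  then obtain a where a: "sigma1 a" "\<And>S. a \<bullet> S = {x. \<Phi> S x}"
    using effective_representable[of \<Phi> thesis] by blast

  \<comment> \<open>The dialogue on a recursive set\<close>
  have "app (adjoin RE K (eq_fun RE K)) a A = Some (- A)" if "recursive A" for A
  proof -
    note A = recursive_sigma1[OF that]
    define e where "e i = pair K (join_meet A (?W i)) ?E" for i
    have sigma1_e: "sigma1 (e i)" for i
      unfolding e_def by (intro pair sigma1_join_meet A sigma1_universal E)
    have answer: "eq_fun RE K (e i) = Some (if ?W i = - A then ?T else ?F)" for i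
      unfolding e_def using eq_fun_pair[OF assms, of "join_meet A (?W i)" ?E]
        sigma1_join_meet[OF A(1) sigma1_universal[of i]] E by (simp add: join_meet_eq_iff)
    have query: "query i (tuple K (A # ys)) = pair K ?F (e i)" if "\<forall>y\<in>set ys. sigma1 y" for i ys
      using q(2)[of "A # ys" 0] A that sigma1_e[of i]
      unfolding query_def e_def
      by (simp add: p(2) TF E pair sigma1_join_meet sigma1_universal)
    have first: "a \<bullet> tuple K [A] = pair K ?F (e 0)"
      using A by (simp add: a(2) \<Phi>_def l(2) count query)
    \<comment> \<open>Earlier answers enter through their number only; \<open>d\<close> branches on
      the latest answer \<open>y\<close>.\<close>
    have later: "a \<bullet> tuple K (A # ys @ [y]) =
        d \<bullet> y \<bullet> pair K ?T (?W (length ys)) \<bullet> pair K ?F (e (Suc (length ys)))"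
      if "\<forall>y\<in>set ys. sigma1 y" "sigma1 y" for ys y
      using A that q(2)[of "A # ys @ [y]" "Suc (length ys)"]
      by (simp add: a(2) \<Phi>_def l(2) count query p(2) TF sigma1_universal nth_append)
    \<comment> \<open>The least index of the complement: the answers before it are all
      \<open>?F\<close>, and the answer to query \<open>m\<close> is \<open>?T\<close>.\<close>
    obtain m where m: "?W m = - A" "\<And>i. i < m \<Longrightarrow> ?W i \<noteq> - A"
      using universal_surj[OF A(2)] exists_least_iff[of "\<lambda>i. ?W i = - A"] by metis
    let ?es = "map e [0..<Suc m]"
    have asks: "a \<bullet> tuple K (A # replicate i ?F) = pair K ?F (e i)" for i
    proof (cases i)
      case 0
      then show ?thesis using first by simp
    next
      case (Suc j)
      then have "replicate i ?F = replicate j ?F @ [?F]" by (simp add: replicate_append_same)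
      then show ?thesis using later[of "replicate j ?F" ?F] Suc
        by (simp add: d pair TF sigma1_universal sigma1_e)
    qed
    have before: "map (the \<circ> eq_fun RE K) (take i ?es) = replicate i ?F" if "i \<le> m" for i
      using that m(2) by (intro nth_equalityI) (auto simp: answer simp del: upt_Suc)
    have "map (the \<circ> eq_fun RE K) ?es = replicate m ?F @ [?T]"
      using before[of m] by (simp add: answer m(1))
    then have "a \<bullet> tuple K (A # map (the \<circ> eq_fun RE K) ?es) = pair K ?T (- A)"
      using later[of "replicate m ?F" ?T] by (simp add: d pair TF A sigma1_e m(1))
    then have "dialogue RE K (eq_fun RE K) a A ?es (- A)"
      unfolding dialogue_def using asks before A
      by (auto simp: sigma1_e answer less_Suc_eq_le simp del: upt_Suc map_map)
    then show ?thesis using app_adjoin_iff[OF assms] by blast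
  qed
  then show ?thesis
    unfolding representable_def using a(1)
    by (intro bexI[of _ a]) (auto simp: complement_fun_def adjoin_def split: if_splits)
qed

end
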